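(* For every integer $n\geq1$, the $(3,1)$-polygraph $\Sigma^{\mathrm{row,coh}}(n)$, obtained from the row presentation $\Sigma^{\mathrm{row}}(n)$ by adjoining for each triple of rows $(u,v,t)\in\mathcal R_n^3$ with $u\not\triangleleft v$ and $v\not\triangleleft t$ one generating $3$-cell $$\mathcal X_{u,v,t}\colon(\alpha_{u,v}1_{r_t})\star_1\Lambda_{\mathcal R(N(uv))r_t}\Rrightarrow(1_{r_u}\alpha_{v,t})\star_1\Lambda_{r_u\mathcal R(N(vt))},$$ is a finite coherent presentation of the stylic monoid $\mathrm{Styl}_n$.
   Context: **Rows and $N$-tableaux.** Fix $n\geq1$, $[n]=\{1<2<\cdots<n\}$. For a word $w$ over $[n]$, $\mathrm{supp}(w)$ is its set of letters. A row is a nonempty strictly increasing word over $[n]$, identified with its support; $\mathcal R_n$ is the set of rows. For rows $u,v$, $u\triangleleft v$ means $\mathrm{supp}(u)\subseteq\mathrm{supp}(v)$ and $\min(v)<\min(u)$. An $N$-tableau $T$ is a finite sequence of rows $u_k,\dots,u_1$ (top to bottom) with $u_{i+1}\triangleleft u_i$ for all $i$; $\mathcal R(T):=r_{u_k}\cdots r_{u_1}$ is its row-generator reading. Right $N$-insertion of a letter $x$: insert $x$ in the bottom row $u_1$, i.e. replace $u_1$ by the row with support $\mathrm{supp}(u_1)\cup\{x\}$; if $u_1$ has a letter $>x$, the smallest such letter $y$ is bumped (it also stays in the row) and is inserted in the same way into the next row above, and so on; a letter bumped from the top row creates a new top row consisting of that letter. For a word $w$, $N(w)$ is obtained by inserting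 its letters from left to right starting from the empty tableau (inserting $x$ in the empty tableau gives the one-row tableau $x$). For rows $u,v$, $N(uv)$ has at most two rows. **Polygraphs.** A $2$-polygraph $\Sigma=(\Sigma_1,\Sigma_2)$ is a set $\Sigma_1$ together with a set $\Sigma_2$ of $2$-cells $\beta\colon u\Rightarrow v$ between words of $\Sigma_1^*$; it presents the quotient of $\Sigma_1^*$ by the congruence generated by $\Sigma_2$. $\Sigma_2^\top$ is the free $(2,1)$-category (track $2$-category) on $\Sigma$; $0$-composition is juxtaposition, $1$-composition is $\star_1$. A $(3,1)$-polygraph $(\Sigma,\Sigma_3)$ is a $2$-polygraph with a set $\Sigma_3$ of generating $3$-cells $A\colon f\Rrightarrow g$ between parallel $2$-cells $f,g$ of $\Sigma_2^\top$. It is a coherent presentation of a monoid $M$ if $\Sigma$ presents $M$ and $\Sigma_3$ is a homotopy basis, i.e. every pair of parallel $2$-cells $(f,g)$ of $\Sigma_2^\top$ is filled by a $3$-cell $f\Rrightarrow g$ of the free $(3,1)$-category generated by $(\Sigma,\Sigma_3)$. It is finite if all generating sets are finite. **Stylic monoid.** $\mathrm{Styl}_n$ is the monoid generated by $[n]$ subject to $xx=x$ ($x\in[n]$), $zxy=xzy$ ($x\leq y<z$), $yzx=yxz$ ($x<y\leq z$). **Row presentation.** $\Sigma^{\mathrm{row}}(n)$ has generating $1$-cells $r_u$, $u\in\mathcal R_n$, and generating $2$-cells $\alpha_{u,v}\colon r_ur_v\Rightarrow\mathcal R(N(uv))$ for all rows $u,v$ with $u\not\triangleleft v$. It is known to be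 convergent (terminating and confluent) and to present $\mathrm{Styl}_n$; its irreducible words are the $\mathcal R(T)$ for $T$ an $N$-tableau. For a word $w$ in the $r_u$, $\Lambda_w\colon w\Rightarrow\widehat w$ denotes the leftmost normalization path from $w$ to its unique normal form $\widehat w$ (always rewrite the leftmost reducible adjacent pair). *)

theory Defs
  imports "HOL-Algebra.Group"
begin

section \<open>Monoids presented by words and relations\<close>

inductive_set word_cong :: "'a set \<Rightarrow> ('a list \<times> 'a list) set \<Rightarrow> ('a list \<times> 'a list) set"
  for X :: "'a set" and Rel :: "('a list \<times> 'a list) set" where
  base: "(u, v) \<in> Rel \<Longrightarrow> {p, u, v, s} \<subseteq> lists X \<Longrightarrow> (p @ u @ s, p @ v @ s) \<in> word_cong X Rel"
| refl: "w \<in> lists X \<Longrightarrow> (w, w) \<in> word_cong X Rel"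
| sym: "(u, v) \<in> word_cong X Rel \<Longrightarrow> (v, u) \<in> word_cong X Rel"
| trans: "(u, v) \<in> word_cong X Rel \<Longrightarrow> (v, w) \<in> word_cong X Rel \<Longrightarrow> (u, w) \<in> word_cong X Rel"

definition presented_monoid :: "'a set \<Rightarrow> ('a list \<times> 'a list) set \<Rightarrow> 'a list set monoid" where
  "presented_monoid X Rel =
    \<lparr>carrier = lists X // word_cong X Rel,
     monoid.mult = (\<lambda>A B. \<Union>u\<in>A. \<Union>v\<in>B. word_cong X Rel `` {u @ v}),
     one = word_cong X Rel `` {[]}\<rparr>"


section \<open>Polygraphs\<close>

record ('a, 'b) polygraph2 =
  cells1 :: "'a set"
  cells2 :: "'b set"
  src2 :: "'b \<Rightarrow> 'a list"
  tgt2 :: "'b \<Rightarrow> 'a list"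

definition is_polygraph2 :: "('a, 'b, 'z) polygraph2_scheme \<Rightarrow> bool" where
  "is_polygraph2 P \<longleftrightarrow>
    (\<forall>b\<in>cells2 P. src2 P b \<in> lists (cells1 P) \<and> tgt2 P b \<in> lists (cells1 P))"

definition polygraph_monoid :: "('a, 'b, 'z) polygraph2_scheme \<Rightarrow> 'a list set monoid" where
  "polygraph_monoid P = presented_monoid (cells1 P) {(src2 P b, tgt2 P b) |b. b \<in> cells2 P}"

text \<open>A bijection that preserves products also preserves the unit, so \<open>\<cong>\<close> is isomorphism of monoids.\<close>

definition presents :: "('a, 'b, 'z) polygraph2_scheme \<Rightarrow> ('m, 'y) monoid_scheme \<Rightarrow> bool" where
  "presents P M \<longleftrightarrow> polygraph_monoid P \<cong> M"


subsection \<open>The free (2,1)-category\<close>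

text \<open>
  The \<open>2\<close>-cells of the free \<open>(2,1)\<close>-category on \<open>P\<close> are the well-typed terms below,
  modulo the congruence \<open>eq2 P\<close> generated by the axioms of (strict) \<open>(2,1)\<close>-categories.
  There is a single \<open>0\<close>-cell. Compositions are written in diagrammatic order.
\<close>

datatype ('a, 'b) term2 =
    Gen2 'b
  | Id1 "'a list"
  | Comp0 "('a, 'b) term2" "('a, 'b) term2"  (infixr "\<star>\<^sub>0" 75)
  | Comp1 "('a, 'b) term2" "('a, 'b) term2"  (infixr "\<star>\<^sub>1" 70)
  | Inv1 "('a, 'b) term2"

inductive cell2 :: "('a, 'b, 'z) polygraph2_scheme \<Rightarrow> ('a, 'b) term2 \<Rightarrow> 'a list \<Rightarrow> 'a list \<Rightarrow> bool"
  for P :: "('a, 'b, 'z) polygraph2_scheme" where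
  gen: "b \<in> cells2 P \<Longrightarrow> cell2 P (Gen2 b) (src2 P b) (tgt2 P b)"
| id: "w \<in> lists (cells1 P) \<Longrightarrow> cell2 P (Id1 w) w w"
| comp0: "cell2 P f u v \<Longrightarrow> cell2 P g u' v' \<Longrightarrow> cell2 P (f \<star>\<^sub>0 g) (u @ u') (v @ v')"
| comp1: "cell2 P f u v \<Longrightarrow> cell2 P g v w \<Longrightarrow> cell2 P (f \<star>\<^sub>1 g) u w"
| inv: "cell2 P f u v \<Longrightarrow> cell2 P (Inv1 f) v u"

definition parallel :: "('a, 'b, 'z) polygraph2_scheme \<Rightarrow> ('a, 'b) term2 \<Rightarrow> ('a, 'b) term2 \<Rightarrow> bool" where
  "parallel P f g \<longleftrightarrow> (\<exists>u v. cell2 P f u v \<and> cell2 P g u v)"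

inductive eq2 :: "('a, 'b, 'z) polygraph2_scheme \<Rightarrow> ('a, 'b) term2 \<Rightarrow> ('a, 'b) term2 \<Rightarrow> bool"
  for P :: "('a, 'b, 'z) polygraph2_scheme" where
  refl: "cell2 P f u v \<Longrightarrow> eq2 P f f"
| sym: "eq2 P f g \<Longrightarrow> eq2 P g f"
| trans: "eq2 P f g \<Longrightarrow> eq2 P g h \<Longrightarrow> eq2 P f h"
| cong0: "eq2 P f f' \<Longrightarrow> eq2 P g g' \<Longrightarrow> eq2 P (f \<star>\<^sub>0 g) (f' \<star>\<^sub>0 g')"
| cong1: "cell2 P f u v \<Longrightarrow> cell2 P g v w \<Longrightarrow> eq2 P f f' \<Longrightarrow> eq2 P g g' \<Longrightarrow>
    eq2 P (f \<star>\<^sub>1 g) (f' \<star>\<^sub>1 g')"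
| cong_inv: "eq2 P f f' \<Longrightarrow> eq2 P (Inv1 f) (Inv1 f')"
| assoc0: "cell2 P f u u' \<Longrightarrow> cell2 P g v v' \<Longrightarrow> cell2 P h w w' \<Longrightarrow>
    eq2 P ((f \<star>\<^sub>0 g) \<star>\<^sub>0 h) (f \<star>\<^sub>0 (g \<star>\<^sub>0 h))"
| unit0_left: "cell2 P f u v \<Longrightarrow> eq2 P (Id1 [] \<star>\<^sub>0 f) f"
| unit0_right: "cell2 P f u v \<Longrightarrow> eq2 P (f \<star>\<^sub>0 Id1 []) f"
| assoc1: "cell2 P f u v \<Longrightarrow> cell2 P g v w \<Longrightarrow> cell2 P h w x \<Longrightarrow>
    eq2 P ((f \<star>\<^sub>1 g) \<star>\<^sub>1 h) (f \<star>\<^sub>1 (g \<star>\<^sub>1 h))"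
| unit1_left: "cell2 P f u v \<Longrightarrow> eq2 P (Id1 u \<star>\<^sub>1 f) f"
| unit1_right: "cell2 P f u v \<Longrightarrow> eq2 P (f \<star>\<^sub>1 Id1 v) f"
| id_comp0: "u \<in> lists (cells1 P) \<Longrightarrow> v \<in> lists (cells1 P) \<Longrightarrow>
    eq2 P (Id1 u \<star>\<^sub>0 Id1 v) (Id1 (u @ v))"
| exchange: "cell2 P f u v \<Longrightarrow> cell2 P f' v w \<Longrightarrow> cell2 P g x y \<Longrightarrow> cell2 P g' y z \<Longrightarrow>
    eq2 P ((f \<star>\<^sub>1 f') \<star>\<^sub>0 (g \<star>\<^sub>1 g')) ((f \<star>\<^sub>0 g) \<star>\<^sub>1 (f' \<star>\<^sub>0 g'))"
| inv_right: "cell2 P f u v \<Longrightarrow> eq2 P (f \<star>\<^sub>1 Inv1 f) (Id1 u)"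
| inv_left: "cell2 P f u v \<Longrightarrow> eq2 P (Inv1 f \<star>\<^sub>1 f) (Id1 v)"


subsection \<open>(3,1)-polygraphs and the free (3,1)-category\<close>

text \<open>Sources and targets of generating \<open>3\<close>-cells are given by representatives modulo \<open>eq2\<close>.\<close>

record ('a, 'b, 'c) polygraph31 = "('a, 'b) polygraph2" +
  cells3 :: "'c set"
  src3 :: "'c \<Rightarrow> ('a, 'b) term2"
  tgt3 :: "'c \<Rightarrow> ('a, 'b) term2"

definition is_polygraph31 :: "('a, 'b, 'c, 'z) polygraph31_scheme \<Rightarrow> bool" where
  "is_polygraph31 P \<longleftrightarrow> is_polygraph2 P \<and> (\<forall>c\<in>cells3 P. parallel P (src3 P c) (tgt3 P c))"

definition finite_polygraph31 :: "('a, 'b, 'c, 'z) polygraph31_scheme \<Rightarrow> bool" where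
  "finite_polygraph31 P \<longleftrightarrow> finite (cells1 P) \<and> finite (cells2 P) \<and> finite (cells3 P)"

datatype ('a, 'b, 'c) term3 =
    Gen3 'c
  | Id2 "('a, 'b) term2"
  | Comp30 "('a, 'b, 'c) term3" "('a, 'b, 'c) term3"  (infixr "\<diamondop>\<^sub>0" 75)
  | Comp31 "('a, 'b, 'c) term3" "('a, 'b, 'c) term3"  (infixr "\<diamondop>\<^sub>1" 70)
  | Comp32 "('a, 'b, 'c) term3" "('a, 'b, 'c) term3"  (infixr "\<diamondop>\<^sub>2" 65)
  | Inv2 "('a, 'b, 'c) term3"

text \<open>
  \<open>cell3 P A f g\<close> means that \<open>A\<close> represents a \<open>3\<close>-cell from the class of \<open>f\<close> to the class
  of \<open>g\<close>; rule \<open>conv\<close> makes the typing depend on these classes only.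
\<close>

inductive cell3 :: "('a, 'b, 'c, 'z) polygraph31_scheme \<Rightarrow> ('a, 'b, 'c) term3 \<Rightarrow>
    ('a, 'b) term2 \<Rightarrow> ('a, 'b) term2 \<Rightarrow> bool"
  for P :: "('a, 'b, 'c, 'z) polygraph31_scheme" where
  gen: "c \<in> cells3 P \<Longrightarrow> cell3 P (Gen3 c) (src3 P c) (tgt3 P c)"
| id: "cell2 P f u v \<Longrightarrow> cell3 P (Id2 f) f f"
| comp0: "cell3 P A f g \<Longrightarrow> cell3 P B f' g' \<Longrightarrow> cell3 P (A \<diamondop>\<^sub>0 B) (f \<star>\<^sub>0 f') (g \<star>\<^sub>0 g')"
| comp1: "cell3 P A f g \<Longrightarrow> cell3 P B f' g' \<Longrightarrow> cell2 P f u v \<Longrightarrow> cell2 P f' v w \<Longrightarrow>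
    cell3 P (A \<diamondop>\<^sub>1 B) (f \<star>\<^sub>1 f') (g \<star>\<^sub>1 g')"
| comp2: "cell3 P A f g \<Longrightarrow> cell3 P B g h \<Longrightarrow> cell3 P (A \<diamondop>\<^sub>2 B) f h"
| inv: "cell3 P A f g \<Longrightarrow> cell3 P (Inv2 A) g f"
| conv: "cell3 P A f g \<Longrightarrow> eq2 P f f' \<Longrightarrow> eq2 P g g' \<Longrightarrow> cell3 P A f' g'"

text \<open>
  The congruence generated by the axioms of (strict) \<open>(3,1)\<close>-categories. Inverses of \<open>3\<close>-cells
  for \<open>\<diamondop>\<^sub>1\<close> need no constructor: if \<open>A\<close> goes from \<open>f\<close> to \<open>g\<close>, its inverse for \<open>\<diamondop>\<^sub>1\<close> is
  \<open>Id2 (Inv1 f) \<diamondop>\<^sub>1 Inv2 A \<diamondop>\<^sub>1 Id2 (Inv1 g)\<close>.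
\<close>

inductive eq3 :: "('a, 'b, 'c, 'z) polygraph31_scheme \<Rightarrow> ('a, 'b, 'c) term3 \<Rightarrow>
    ('a, 'b, 'c) term3 \<Rightarrow> bool"
  for P :: "('a, 'b, 'c, 'z) polygraph31_scheme" where
  refl: "cell3 P A f g \<Longrightarrow> eq3 P A A"
| sym: "eq3 P A B \<Longrightarrow> eq3 P B A"
| trans: "eq3 P A B \<Longrightarrow> eq3 P B C \<Longrightarrow> eq3 P A C"
| cong_id: "eq2 P f g \<Longrightarrow> eq3 P (Id2 f) (Id2 g)"
| cong0: "cell3 P (A \<diamondop>\<^sub>0 B) f g \<Longrightarrow> eq3 P A A' \<Longrightarrow> eq3 P B B' \<Longrightarrow> eq3 P (A \<diamondop>\<^sub>0 B) (A' \<diamondop>\<^sub>0 B')"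
| cong1: "cell3 P (A \<diamondop>\<^sub>1 B) f g \<Longrightarrow> eq3 P A A' \<Longrightarrow> eq3 P B B' \<Longrightarrow> eq3 P (A \<diamondop>\<^sub>1 B) (A' \<diamondop>\<^sub>1 B')"
| cong2: "cell3 P (A \<diamondop>\<^sub>2 B) f g \<Longrightarrow> eq3 P A A' \<Longrightarrow> eq3 P B B' \<Longrightarrow> eq3 P (A \<diamondop>\<^sub>2 B) (A' \<diamondop>\<^sub>2 B')"
| cong_inv: "eq3 P A A' \<Longrightarrow> eq3 P (Inv2 A) (Inv2 A')"
| assoc0: "cell3 P ((A \<diamondop>\<^sub>0 B) \<diamondop>\<^sub>0 C) f g \<Longrightarrow> eq3 P ((A \<diamondop>\<^sub>0 B) \<diamondop>\<^sub>0 C) (A \<diamondop>\<^sub>0 (B \<diamondop>\<^sub>0 C))"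
| assoc1: "cell3 P ((A \<diamondop>\<^sub>1 B) \<diamondop>\<^sub>1 C) f g \<Longrightarrow> eq3 P ((A \<diamondop>\<^sub>1 B) \<diamondop>\<^sub>1 C) (A \<diamondop>\<^sub>1 (B \<diamondop>\<^sub>1 C))"
| assoc2: "cell3 P ((A \<diamondop>\<^sub>2 B) \<diamondop>\<^sub>2 C) f g \<Longrightarrow> eq3 P ((A \<diamondop>\<^sub>2 B) \<diamondop>\<^sub>2 C) (A \<diamondop>\<^sub>2 (B \<diamondop>\<^sub>2 C))"
| unit0_left: "cell3 P A f g \<Longrightarrow> eq3 P (Id2 (Id1 []) \<diamondop>\<^sub>0 A) A"
| unit0_right: "cell3 P A f g \<Longrightarrow> eq3 P (A \<diamondop>\<^sub>0 Id2 (Id1 [])) A"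
| unit1_left: "cell3 P A f g \<Longrightarrow> cell2 P f u v \<Longrightarrow> eq3 P (Id2 (Id1 u) \<diamondop>\<^sub>1 A) A"
| unit1_right: "cell3 P A f g \<Longrightarrow> cell2 P f u v \<Longrightarrow> eq3 P (A \<diamondop>\<^sub>1 Id2 (Id1 v)) A"
| unit2_left: "cell3 P A f g \<Longrightarrow> eq3 P (Id2 f \<diamondop>\<^sub>2 A) A"
| unit2_right: "cell3 P A f g \<Longrightarrow> eq3 P (A \<diamondop>\<^sub>2 Id2 g) A"
| id_comp0: "cell2 P (f \<star>\<^sub>0 g) u v \<Longrightarrow> eq3 P (Id2 f \<diamondop>\<^sub>0 Id2 g) (Id2 (f \<star>\<^sub>0 g))"
| id_comp1: "cell2 P (f \<star>\<^sub>1 g) u v \<Longrightarrow> eq3 P (Id2 f \<diamondop>\<^sub>1 Id2 g) (Id2 (f \<star>\<^sub>1 g))"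
| exchange01: "cell3 P ((A \<diamondop>\<^sub>1 A') \<diamondop>\<^sub>0 (B \<diamondop>\<^sub>1 B')) f g \<Longrightarrow>
    eq3 P ((A \<diamondop>\<^sub>1 A') \<diamondop>\<^sub>0 (B \<diamondop>\<^sub>1 B')) ((A \<diamondop>\<^sub>0 B) \<diamondop>\<^sub>1 (A' \<diamondop>\<^sub>0 B'))"
| exchange02: "cell3 P ((A \<diamondop>\<^sub>2 A') \<diamondop>\<^sub>0 (B \<diamondop>\<^sub>2 B')) f g \<Longrightarrow>
    eq3 P ((A \<diamondop>\<^sub>2 A') \<diamondop>\<^sub>0 (B \<diamondop>\<^sub>2 B')) ((A \<diamondop>\<^sub>0 B) \<diamondop>\<^sub>2 (A' \<diamondop>\<^sub>0 B'))"
| exchange12: "cell3 P ((A \<diamondop>\<^sub>2 A') \<diamondop>\<^sub>1 (B \<diamondop>\<^sub>2 B')) f g \<Longrightarrow>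
    eq3 P ((A \<diamondop>\<^sub>2 A') \<diamondop>\<^sub>1 (B \<diamondop>\<^sub>2 B')) ((A \<diamondop>\<^sub>1 B) \<diamondop>\<^sub>2 (A' \<diamondop>\<^sub>1 B'))"
| inv_right: "cell3 P A f g \<Longrightarrow> eq3 P (A \<diamondop>\<^sub>2 Inv2 A) (Id2 f)"
| inv_left: "cell3 P A f g \<Longrightarrow> eq3 P (Inv2 A \<diamondop>\<^sub>2 A) (Id2 g)"

definition free_hom3 :: "('a, 'b, 'c, 'z) polygraph31_scheme \<Rightarrow> ('a, 'b) term2 \<Rightarrow> ('a, 'b) term2 \<Rightarrow>
    ('a, 'b, 'c) term3 set set" where
  "free_hom3 P f g = {A. cell3 P A f g} // {(A, B). eq3 P A B}"

definition homotopy_basis :: "('a, 'b, 'c, 'z) polygraph31_scheme \<Rightarrow> bool" where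
  "homotopy_basis P \<longleftrightarrow> (\<forall>f g. parallel P f g \<longrightarrow> (\<exists>X. X \<in> free_hom3 P f g))"

definition coherent_presentation ::
    "('a, 'b, 'c, 'z) polygraph31_scheme \<Rightarrow> ('m, 'y) monoid_scheme \<Rightarrow> bool" where
  "coherent_presentation P M \<longleftrightarrow> is_polygraph31 P \<and> presents P M \<and> homotopy_basis P"


section \<open>The stylic monoid\<close>

definition stylic_relations :: "nat \<Rightarrow> (nat list \<times> nat list) set" where
  "stylic_relations n =
     {([x, x], [x]) |x. x \<in> {1..n}} \<union>
     {([z, x, y], [x, z, y]) |x y z. {x, y, z} \<subseteq> {1..n} \<and> x \<le> y \<and> y < z} \<union>
     {([y, z, x], [y, x, z]) |x y z. {x, y, z} \<subseteq> {1..n} \<and> x < y \<and> y \<le> z}"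

definition Styl :: "nat \<Rightarrow> nat list set monoid" where
  "Styl n = presented_monoid {1..n} (stylic_relations n)"


section \<open>Rows and right N-insertion\<close>

type_synonym row = "nat list"

definition rows :: "nat \<Rightarrow> row set" where
  "rows n = {u. u \<noteq> [] \<and> sorted_wrt (<) u \<and> set u \<subseteq> {1..n}}"

definition row_rel :: "row \<Rightarrow> row \<Rightarrow> bool"  (infix "\<triangleleft>" 50) where
  "u \<triangleleft> v \<longleftrightarrow> set u \<subseteq> set v \<and> Min (set v) < Min (set u)"

text \<open>A tableau with rows \<open>u\<^sub>k, \<dots>, u\<^sub>1\<close> from top to bottom is the list \<open>[u\<^sub>1, \<dots>, u\<^sub>k]\<close>.\<close>

fun N_insert :: "nat \<Rightarrow> row list \<Rightarrow> row list" where
  "N_insert x [] = [[x]]"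
| "N_insert x (u # T) =
     sorted_list_of_set (insert x (set u)) #
       (if \<exists>y\<in>set u. x < y then N_insert (Min {y \<in> set u. x < y}) T else T)"

definition N_tab :: "nat list \<Rightarrow> row list" where
  "N_tab w = fold N_insert w []"

text \<open>The generator \<open>r\<^sub>u\<close> of the row presentation is represented by the row \<open>u\<close> itself.\<close>

definition reading :: "row list \<Rightarrow> row list" where
  "reading T = rev T"


section \<open>The coherent row presentation\<close>

definition row_presentation :: "nat \<Rightarrow> (row, row \<times> row) polygraph2" where
  "row_presentation n =
    \<lparr>cells1 = rows n,
     cells2 = {(u, v). u \<in> rows n \<and> v \<in> rows n \<and> \<not> u \<triangleleft> v},
     src2 = (\<lambda>(u, v). [u, v]),
     tgt2 = (\<lambda>(u, v). reading (N_tab (u @ v)))\<rparr>"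

abbreviation \<alpha> :: "row \<Rightarrow> row \<Rightarrow> (row, row \<times> row) term2" where
  "\<alpha> u v \<equiv> Gen2 (u, v)"

text \<open>
  In \<open>step\<close>, the reducible pair \<open>(u, v)\<close> is the leftmost one, since no pair of adjacent letters
  of \<open>p @ [u]\<close> is reducible.
\<close>

inductive leftmost_path :: "row list \<Rightarrow> (row, row \<times> row) term2 \<Rightarrow> bool" where
  normal: "successively (\<triangleleft>) w \<Longrightarrow> leftmost_path w (Id1 w)"
| step: "successively (\<triangleleft>) (p @ [u]) \<Longrightarrow> \<not> u \<triangleleft> v \<Longrightarrow>
    leftmost_path (p @ reading (N_tab (u @ v)) @ s) f \<Longrightarrow>
    leftmost_path (p @ [u, v] @ s) ((Id1 p \<star>\<^sub>0 \<alpha> u v \<star>\<^sub>0 Id1 s) \<star>\<^sub>1 f)"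

definition \<Lambda> :: "row list \<Rightarrow> (row, row \<times> row) term2" where
  "\<Lambda> w = (THE f. leftmost_path w f)"

lemma leftmost_path_unique:
  assumes "leftmost_path w f" "leftmost_path w g"
  shows "f = g"
  using assms
proof (induction arbitrary: g rule: leftmost_path.induct)
  case (normal w)
  from normal(2,1) show ?case
    by cases (auto simp: successively_append_iff)
next
  case (step p u v s f)
  have aux: "p = p' \<and> u = u' \<and> v = v' \<and> s = s'"
    if eq: "p @ [u, v] @ s = p' @ [u', v'] @ s'"
      and "successively (\<triangleleft>) (p' @ [u'])" "\<not> u' \<triangleleft> v'" for p' u' v' s'
  proof -
    have "\<not> length p < length p'"
    proof
      assume "length p < length p'"
      then obtain r where "p' @ [u'] = p @ [u, v] @ r"
        using eq by (auto simp: append_eq_append_conv2 append_eq_Cons_conv Cons_eq_append_conv)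
      with that step.hyps show False by (auto simp: successively_append_iff)
    qed
    moreover have "\<not> length p' < length p"
    proof
      assume "length p' < length p"
      then obtain r where "p @ [u] = p' @ [u', v'] @ r"
        using eq by (auto simp: append_eq_append_conv2 append_eq_Cons_conv Cons_eq_append_conv)
      with that step.hyps show False by (auto simp: successively_append_iff)
    qed
    ultimately have "length p = length p'" by simp
    with eq show ?thesis by simp
  qed
  from step.prems show ?case
  proof cases
    case normal
    with step.hyps show ?thesis by (auto simp: successively_append_iff)
  next
    case (step p' u' v' s' f')
    with aux[of p' u' v' s'] step.IH show ?thesis by auto
  qed
qed

definition row_coh :: "nat \<Rightarrow> (row, row \<times> row, row \<times> row \<times> row) polygraph31" where
  "row_coh n = polygraph2.extend (row_presentation n)
    \<lparr>cells3 = {(u, v, t). u \<in> rows n \<and> v \<in> rows n \<and> t \<in> rows n \<and> \<not> u \<triangleleft> v \<and> \<not> v \<triangleleft> t},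
     src3 = (\<lambda>(u, v, t). (\<alpha> u v \<star>\<^sub>0 Id1 [t]) \<star>\<^sub>1 \<Lambda> (reading (N_tab (u @ v)) @ [t])),
     tgt3 = (\<lambda>(u, v, t). (Id1 [u] \<star>\<^sub>0 \<alpha> v t) \<star>\<^sub>1 \<Lambda> ([u] @ reading (N_tab (v @ t))))\<rparr>"

end

theory Submission
  imports Defs
begin

text \<open>
  Right \<open>N\<close>-insertion is compatible with the stylic relations and every word is congruent to the
  reading of its tableau, so tableaux form a section of the stylic congruence and a word of rows
  has the reading of its tableau as unique normal form. Hence confluence needs no analysis of
  critical branchings; only termination does need an argument. Coherence is Squier's argument:
  by noetherian induction on \<open>w\<close>, every rewriting step \<open>w \<Rightarrow> w'\<close> followed by \<open>\<Lambda> w'\<close> is homotopic to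
  \<open>\<Lambda> w\<close>. Compared with the leftmost step, a step is either equal to it, disjoint from it (exchange
  law), or overlapping it (a generating \<open>3\<close>-cell). Thus any \<open>2\<close>-cell \<open>f : u \<Rightarrow> v\<close> is homotopic to
  \<open>\<Lambda> u \<star>\<^sub>1 Inv1 (\<Lambda> v)\<close>, which depends on \<open>u\<close> and \<open>v\<close> only.
\<close>

text \<open>A path that is leftmost for a word \<open>x\<close> is in general no longer leftmost
  once \<open>x\<close> stands to the right of other rows. Each side of a generating 3-cell ends
  with such a path, so in a context neither side is of the form "step followed by \<Lambda>". Both
  sides are therefore continued to a common word and compared with \<Lambda> step by step; this
  consumes the induction hypothesis at words arbitrarily far below \<open>w\<close>. The leftmost
  strategy makes the comparison of redexes one-sided: any other redex starts strictly to the right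
  of the leftmost one. If it is disjoint from it, rewriting it keeps the leftmost redex leftmost; if
  it overlaps it, the two share exactly one row. Termination is delicate because
  \<open>N(uv)\<close> may again have two rows, and the total number of letters can grow: the rows
  23 and 1 become 2 and 123.\<close>

declare word_cong.trans [trans] eq2.trans [trans]
declare sorted_list_of_set_insert_remove [simp del]

section \<open>Presented monoids\<close>

lemma word_cong_append:
  assumes "(u, v) \<in> word_cong X R" "p \<in> lists X" "s \<in> lists X"
  shows "(p @ u @ s, p @ v @ s) \<in> word_cong X R"
  using assms
proof (induction arbitrary: p s rule: word_cong.induct)
  case (base u v p' s')
  then show ?case
    using word_cong.base[of u v R "p @ p'" "s' @ s" X] by simp
next
  case (refl w)
  then show ?case by (intro word_cong.refl) auto
qed (blast intro: word_cong.sym word_cong.trans)+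

lemma word_cong_in_lists: "(u, v) \<in> word_cong X R \<Longrightarrow> u \<in> lists X \<and> v \<in> lists X"
  by (induction rule: word_cong.induct) auto

lemma equiv_word_cong: "equiv (lists X) (word_cong X R)"
  using word_cong_in_lists[of _ _ X R]
  by (intro equivI)
    (auto simp: refl_on_def intro!: symI transI intro: word_cong.refl word_cong.sym word_cong.trans)

lemma word_cong_append2:
  assumes "(u, u') \<in> word_cong X R" "(v, v') \<in> word_cong X R"
  shows "(u @ v, u' @ v') \<in> word_cong X R"
proof -
  have "(u @ v, u' @ v) \<in> word_cong X R"
    using word_cong_append[OF assms(1), of "[]" v] word_cong_in_lists[OF assms(2)] by auto
  also have "(u' @ v, u' @ v') \<in> word_cong X R"
    using word_cong_append[OF assms(2), of u' "[]"] word_cong_in_lists[OF assms(1)] by auto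
  finally show ?thesis .
qed

lemma presented_monoid_mult:
  assumes "u \<in> lists X" "v \<in> lists X"
  shows "monoid.mult (presented_monoid X R) (word_cong X R `` {u}) (word_cong X R `` {v}) =
    word_cong X R `` {u @ v}"
  using assms word_cong_append2[of u _ X R v]
  by (auto simp: presented_monoid_def Image_iff intro: word_cong.trans word_cong.refl)

lemma presented_monoid_iso:
  fixes h :: "'a list \<Rightarrow> 'b list"
  assumes h: "\<And>u. u \<in> lists X \<Longrightarrow> h u \<in> lists Y"
    and app: "\<And>u v. h (u @ v) = h u @ h v"
    and iff: "\<And>u v. u \<in> lists X \<Longrightarrow> v \<in> lists X \<Longrightarrow>
      (u, v) \<in> word_cong X R \<longleftrightarrow> (h u, h v) \<in> word_cong Y S"
    and surj: "\<And>w. w \<in> lists Y \<Longrightarrow> \<exists>u\<in>lists X. (h u, w) \<in> word_cong Y S"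
  shows "presented_monoid X R \<cong> presented_monoid Y S"
proof -
  let ?C = "\<lambda>u. word_cong X R `` {u}" and ?D = "\<lambda>u. word_cong Y S `` {u}"
  let ?\<phi> = "\<lambda>A. \<Union>u\<in>A. ?D (h u)"
  \<comment> \<open>All classes in this union coincide, since \<open>h\<close> sends congruent words
    to congruent words.\<close>
  have \<phi>: "?\<phi> (?C u) = ?D (h u)" if "u \<in> lists X" for u
  proof -
    have "?D (h v) = ?D (h u)" if "v \<in> ?C u" for v
      using that iff[of u v] word_cong_in_lists[of u v X R]
      by (intro equiv_class_eq[OF equiv_word_cong]) (auto intro: word_cong.sym)
    moreover have "u \<in> ?C u" using that by (auto intro: word_cong.refl)
    ultimately show ?thesis by blast
  qed
  have C: "carrier (presented_monoid X R) = ?C ` lists X"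
    "carrier (presented_monoid Y S) = ?D ` lists Y"
    by (auto simp: presented_monoid_def quotient_def)
  have "?\<phi> \<in> hom (presented_monoid X R) (presented_monoid Y S)"
  proof (rule homI)
    fix A assume "A \<in> carrier (presented_monoid X R)"
    then obtain u where u: "u \<in> lists X" "A = ?C u" unfolding C by blast
    then show "?\<phi> A \<in> carrier (presented_monoid Y S)"
      unfolding C u(2) \<phi>[OF u(1)] using h by blast
    fix B assume "B \<in> carrier (presented_monoid X R)"
    then obtain v where v: "v \<in> lists X" "B = ?C v" unfolding C by blast
    have uv: "u @ v \<in> lists X" using u v by simp
    show "?\<phi> (A \<otimes>\<^bsub>presented_monoid X R\<^esub> B) = ?\<phi> A \<otimes>\<^bsub>presented_monoid Y S\<^esub> ?\<phi> B"
      unfolding u(2) v(2) presented_monoid_mult[OF u(1) v(1)] \<phi>[OF uv] \<phi>[OF u(1)] \<phi>[OF v(1)]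
        presented_monoid_mult[OF h[OF u(1)] h[OF v(1)]] app ..
  qed
  moreover have "bij_betw ?\<phi> (carrier (presented_monoid X R)) (carrier (presented_monoid Y S))"
    unfolding bij_betw_def C
  proof
    show "inj_on ?\<phi> (?C ` lists X)"
    proof (rule inj_onI, elim imageE)
      fix A B u v assume *: "?\<phi> A = ?\<phi> B" "A = ?C u" "B = ?C v" "u \<in> lists X" "v \<in> lists X"
      then have "?D (h u) = ?D (h v)" by (metis \<phi>)
      then have "(h u, h v) \<in> word_cong Y S"
        by (rule eq_equiv_class[OF _ equiv_word_cong]) (rule h[OF *(5)])
      then show "A = B"
        unfolding *(2,3) by (intro equiv_class_eq[OF equiv_word_cong]) (simp add: iff[OF *(4,5)])
    qed
    have "\<exists>u\<in>lists X. ?D w = ?D (h u)" if "w \<in> lists Y" for w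
      using surj[OF that] equiv_class_eq[OF equiv_word_cong, of _ w Y S] by blast
    then show "?\<phi> ` (?C ` lists X) = ?D ` lists Y"
      unfolding image_image using h by (simp add: \<phi> cong: image_cong_simp) blast
  qed
  ultimately show ?thesis by (auto simp: is_iso_def iso_def)
qed

text \<open>Forgets a 2-cell down to the congruence it witnesses; applied to \<Lambda>, it makes
  every word of rows congruent to its normal form.\<close>

lemma cell2_imp_word_cong:
  assumes "is_polygraph2 P" "cell2 P f u v"
  shows "(u, v) \<in> word_cong (cells1 P) {(src2 P b, tgt2 P b) |b. b \<in> cells2 P}"
  using assms(2)
proof induction
  case (gen b)
  then show ?case
    using word_cong.base[of "src2 P b" "tgt2 P b" "{(src2 P b, tgt2 P b) |b. b \<in> cells2 P}" "[]" "[]" "cells1 P"]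
      assms(1) by (auto simp: is_polygraph2_def)
qed (auto intro: word_cong.refl word_cong.sym word_cong.trans word_cong_append2)

section \<open>Whiskering and homotopy of 2-cells\<close>

abbreviation whisk :: "'a list \<Rightarrow> ('a, 'b) term2 \<Rightarrow> 'a list \<Rightarrow> ('a, 'b) term2" where
  "whisk p f s \<equiv> Id1 p \<star>\<^sub>0 f \<star>\<^sub>0 Id1 s"

lemma cell2_whisk:
  "cell2 P f u v \<Longrightarrow> p \<in> lists (cells1 P) \<Longrightarrow> s \<in> lists (cells1 P) \<Longrightarrow>
    cell2 P (whisk p f s) (p @ u @ s) (p @ v @ s)"
  by (intro cell2.comp0 cell2.id) auto

lemma cell2_in_lists:
  "is_polygraph2 P \<Longrightarrow> cell2 P f u v \<Longrightarrow> u \<in> lists (cells1 P) \<and> v \<in> lists (cells1 P)"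
  by (rotate_tac, induction rule: cell2.induct) (auto simp: is_polygraph2_def)

lemma eq2_whisk_Id:
  assumes "p \<in> lists (cells1 P)" "w \<in> lists (cells1 P)" "s \<in> lists (cells1 P)"
  shows "eq2 P (whisk p (Id1 w) s) (Id1 (p @ w @ s))"
proof -
  have "eq2 P (whisk p (Id1 w) s) (Id1 p \<star>\<^sub>0 Id1 (w @ s))"
    using assms by (intro eq2.cong0 eq2.id_comp0 eq2.refl[OF cell2.id]) auto
  also have "eq2 P (Id1 p \<star>\<^sub>0 Id1 (w @ s)) (Id1 (p @ w @ s))"
    using assms by (intro eq2.id_comp0) auto
  finally show ?thesis .
qed

lemma eq2_whisk_Nil:
  assumes "cell2 P f u v"
  shows "eq2 P (whisk [] f []) f"
proof -
  have "cell2 P (f \<star>\<^sub>0 Id1 []) (u @ []) (v @ [])"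
    by (intro cell2.comp0 cell2.id assms) auto
  from eq2.trans[OF eq2.unit0_left[OF this] eq2.unit0_right[OF assms]] show ?thesis .
qed

lemma eq2_whisk_whisk:
  assumes f: "cell2 P f u v"
    and ps: "p \<in> lists (cells1 P)" "s \<in> lists (cells1 P)"
      "p' \<in> lists (cells1 P)" "s' \<in> lists (cells1 P)"
  shows "eq2 P (whisk p (whisk p' f s') s) (whisk (p @ p') f (s' @ s))"
proof -
  note id = cell2.id[OF ps(1)] cell2.id[OF ps(2)] cell2.id[OF ps(3)] cell2.id[OF ps(4)]
  note r = eq2.refl[OF id(1)] eq2.refl[OF id(2)] eq2.refl[OF id(3)] eq2.refl[OF id(4)]
  have "eq2 P (whisk p (whisk p' f s') s) (Id1 p \<star>\<^sub>0 Id1 p' \<star>\<^sub>0 ((f \<star>\<^sub>0 Id1 s') \<star>\<^sub>0 Id1 s))"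
    by ((rule eq2.cong0[OF r(1) eq2.assoc0]), (rule id f cell2.comp0)+)
  also have "eq2 P \<dots> (Id1 p \<star>\<^sub>0 Id1 p' \<star>\<^sub>0 f \<star>\<^sub>0 Id1 s' \<star>\<^sub>0 Id1 s)"
    by (rule eq2.cong0[OF r(1) eq2.cong0[OF r(3) eq2.assoc0[OF f id(4,2)]]])
  also have "eq2 P \<dots> (Id1 p \<star>\<^sub>0 Id1 p' \<star>\<^sub>0 f \<star>\<^sub>0 Id1 (s' @ s))"
    using ps by (intro eq2.cong0 r eq2.refl[OF f] eq2.id_comp0)
  also have "eq2 P \<dots> ((Id1 p \<star>\<^sub>0 Id1 p') \<star>\<^sub>0 f \<star>\<^sub>0 Id1 (s' @ s))"
    by (rule eq2.sym[OF eq2.assoc0[OF id(1,3) cell2.comp0[OF f cell2.id]]]) (use ps in auto)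
  also have "eq2 P \<dots> (whisk (p @ p') f (s' @ s))"
    using ps by (intro eq2.cong0 eq2.id_comp0 eq2.refl[OF f] eq2.refl[OF cell2.id]) auto
  finally show ?thesis .
qed

lemma eq2_whisk_comp1:
  assumes fg: "cell2 P f u v" "cell2 P g v w"
    and ps: "p \<in> lists (cells1 P)" "s \<in> lists (cells1 P)"
  shows "eq2 P (whisk p (f \<star>\<^sub>1 g) s) (whisk p f s \<star>\<^sub>1 whisk p g s)"
proof -
  note id = cell2.id[OF ps(1)] cell2.id[OF ps(2)]
  have d: "eq2 P (Id1 w) (Id1 w \<star>\<^sub>1 Id1 w)" if "w \<in> lists (cells1 P)" for w
    by (rule eq2.sym[OF eq2.unit1_left] cell2.id that)+
  have "eq2 P (whisk p (f \<star>\<^sub>1 g) s) ((Id1 p \<star>\<^sub>1 Id1 p) \<star>\<^sub>0 ((f \<star>\<^sub>1 g) \<star>\<^sub>0 (Id1 s \<star>\<^sub>1 Id1 s)))"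
    using ps by (intro eq2.cong0 d eq2.refl[OF cell2.comp1[OF fg]])
  also have "eq2 P \<dots> ((Id1 p \<star>\<^sub>1 Id1 p) \<star>\<^sub>0 ((f \<star>\<^sub>0 Id1 s) \<star>\<^sub>1 (g \<star>\<^sub>0 Id1 s)))"
    by (rule eq2.cong0, rule eq2.refl[OF cell2.comp1], (rule eq2.exchange id fg)+)
  also have "eq2 P \<dots> (whisk p f s \<star>\<^sub>1 whisk p g s)"
    by (rule eq2.exchange id fg cell2.comp0)+
  finally show ?thesis .
qed

text \<open>Padding each cell with an identity and applying the exchange law puts the two cells in
  sequence, in either order.\<close>

lemma eq2_comp0_split:
  assumes f: "cell2 P f u v" and g: "cell2 P g u' v'"
    and L: "{u, v, u', v'} \<subseteq> lists (cells1 P)"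
  shows "eq2 P (f \<star>\<^sub>0 g) (whisk [] f u' \<star>\<^sub>1 whisk v g [])"
    and "eq2 P (f \<star>\<^sub>0 g) (whisk u g [] \<star>\<^sub>1 whisk [] f v')"
proof -
  have L: "u \<in> lists (cells1 P)" "v \<in> lists (cells1 P)"
    "u' \<in> lists (cells1 P)" "v' \<in> lists (cells1 P)"
    using L by auto
  note id = L[THEN cell2.id]
  have n: "cell2 P (f' \<star>\<^sub>0 g') (x @ x') (y @ y') \<Longrightarrow> eq2 P (f' \<star>\<^sub>0 g') (Id1 [] \<star>\<^sub>0 (f' \<star>\<^sub>0 g'))"
    "cell2 P g' x y \<Longrightarrow> eq2 P g' (g' \<star>\<^sub>0 Id1 [])" for f' g' x y x' y'
    by (blast intro: eq2.sym[OF eq2.unit0_left] eq2.sym[OF eq2.unit0_right])+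
  have "eq2 P (f \<star>\<^sub>0 g) ((f \<star>\<^sub>1 Id1 v) \<star>\<^sub>0 (Id1 u' \<star>\<^sub>1 g))"
    by (rule eq2.cong0 eq2.sym[OF eq2.unit1_right] eq2.sym[OF eq2.unit1_left] f g)+
  also have "eq2 P \<dots> ((f \<star>\<^sub>0 Id1 u') \<star>\<^sub>1 (Id1 v \<star>\<^sub>0 g))"
    by (rule eq2.exchange f g id)+
  also have "eq2 P \<dots> (whisk [] f u' \<star>\<^sub>1 whisk v g [])"
    by (rule eq2.cong1 cell2.comp0 f g id n eq2.cong0 eq2.refl[OF id(2)])+
  finally show "eq2 P (f \<star>\<^sub>0 g) (whisk [] f u' \<star>\<^sub>1 whisk v g [])" .
  have "eq2 P (f \<star>\<^sub>0 g) ((Id1 u \<star>\<^sub>1 f) \<star>\<^sub>0 (g \<star>\<^sub>1 Id1 v'))"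
    by (rule eq2.cong0 eq2.sym[OF eq2.unit1_right] eq2.sym[OF eq2.unit1_left] f g)+
  also have "eq2 P \<dots> ((Id1 u \<star>\<^sub>0 g) \<star>\<^sub>1 (f \<star>\<^sub>0 Id1 v'))"
    by (rule eq2.exchange f g id)+
  also have "eq2 P \<dots> (whisk u g [] \<star>\<^sub>1 whisk [] f v')"
    by (rule eq2.cong1 cell2.comp0 f g id n eq2.cong0 eq2.refl[OF id(1)])+
  finally show "eq2 P (f \<star>\<^sub>0 g) (whisk u g [] \<star>\<^sub>1 whisk [] f v')" .
qed

text \<open>Coherence asks only for the existence of fillers, so 3-cells can be handled as a
  relation between 2-cells that is compatible with both compositions.\<close>

definition htpy :: "('a, 'b, 'c, 'z) polygraph31_scheme \<Rightarrow> ('a, 'b) term2 \<Rightarrow> ('a, 'b) term2 \<Rightarrow> bool"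
  where "htpy P f g \<longleftrightarrow> (\<exists>A. cell3 P A f g)"

lemma htpy_gen: "c \<in> cells3 P \<Longrightarrow> htpy P (src3 P c) (tgt3 P c)"
  by (auto simp: htpy_def intro: cell3.gen)

text \<open>The filler is the identity 3-cell on \<open>f\<close>, retyped along \<open>eq2\<close>
  by rule \<open>conv\<close>.\<close>

lemma htpy_eq2: "eq2 P f g \<Longrightarrow> cell2 P f u v \<Longrightarrow> htpy P f g"
  unfolding htpy_def by (blast intro: cell3.id cell3.conv eq2.refl)

lemma htpy_eq2': "eq2 P g f \<Longrightarrow> cell2 P f u v \<Longrightarrow> htpy P f g"
  using htpy_eq2 eq2.sym by blast

lemma htpy_refl: "cell2 P f u v \<Longrightarrow> htpy P f f"
  by (blast intro: htpy_eq2 eq2.refl)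

lemma htpy_sym: "htpy P f g \<Longrightarrow> htpy P g f"
  unfolding htpy_def by (blast intro: cell3.inv)

lemma htpy_trans [trans]: "htpy P f g \<Longrightarrow> htpy P g h \<Longrightarrow> htpy P f h"
  unfolding htpy_def by (blast intro: cell3.comp2)

lemma htpy_comp0: "htpy P f g \<Longrightarrow> htpy P f' g' \<Longrightarrow> htpy P (f \<star>\<^sub>0 f') (g \<star>\<^sub>0 g')"
  unfolding htpy_def by (blast intro: cell3.comp0)

lemma htpy_comp1:
  "htpy P f g \<Longrightarrow> htpy P f' g' \<Longrightarrow> cell2 P f u v \<Longrightarrow> cell2 P f' v w \<Longrightarrow>
    htpy P (f \<star>\<^sub>1 f') (g \<star>\<^sub>1 g')"
  unfolding htpy_def by (blast intro: cell3.comp1)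

lemma htpy_whisk:
  "htpy P f g \<Longrightarrow> p \<in> lists (cells1 P) \<Longrightarrow> s \<in> lists (cells1 P) \<Longrightarrow>
    htpy P (whisk p f s) (whisk p g s)"
  by (intro htpy_comp0 htpy_refl[OF cell2.id])

lemma homotopy_basisI:
  assumes "\<And>f g u v. cell2 P f u v \<Longrightarrow> cell2 P g u v \<Longrightarrow> htpy P f g"
  shows "homotopy_basis P"
  unfolding homotopy_basis_def
proof (intro allI impI)
  fix f g assume "parallel P f g"
  then have "htpy P f g" using assms by (auto simp: parallel_def)
  then show "\<exists>X. X \<in> free_hom3 P f g"
    by (auto simp: htpy_def free_hom3_def quotient_def)
qed

text \<open>Once the gap \<open>q\<close> is absorbed into the second cell, both sides are
  sequential forms of one \<open>\<star>\<^sub>0\<close>-composite, whiskered by \<open>p\<close>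
  and \<open>s\<close>.\<close>

lemma eq2_whisk_exchange:
  assumes f: "cell2 P f u u'" and g: "cell2 P g v v'"
    and L: "{p, q, s, u, u', v, v'} \<subseteq> lists (cells1 P)"
  shows "eq2 P (whisk (p @ u @ q) g s \<star>\<^sub>1 whisk p f (q @ v' @ s))
    (whisk p f (q @ v @ s) \<star>\<^sub>1 whisk (p @ u' @ q) g s)"
proof -
  have ps: "p \<in> lists (cells1 P)" "s \<in> lists (cells1 P)" "q \<in> lists (cells1 P)"
    "[] \<in> lists (cells1 P)" and
    uv: "u \<in> lists (cells1 P)" "u' \<in> lists (cells1 P)"
    "q @ v \<in> lists (cells1 P)" "q @ v' \<in> lists (cells1 P)"
    using L by auto
  let ?h = "whisk q g []"
  have h: "cell2 P ?h (q @ v) (q @ v')"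
    using cell2_whisk[OF g ps(3,4)] by simp
  have cf: "cell2 P (whisk [] f x) (u @ x) (u' @ x)" if "x \<in> lists (cells1 P)" for x
    using cell2_whisk[OF f ps(4) that] by simp
  have cg: "cell2 P (whisk x ?h []) (x @ q @ v) (x @ q @ v')" if "x \<in> lists (cells1 P)" for x
    using cell2_whisk[OF h that ps(4)] by simp
  have ff: "eq2 P (whisk p (whisk [] f x) s) (whisk p f (x @ s))" if "x \<in> lists (cells1 P)" for x
    using eq2_whisk_whisk[OF f ps(1,2,4) that] by simp
  have gg: "eq2 P (whisk p (whisk x ?h []) s) (whisk (p @ x @ q) g s)" if "x \<in> lists (cells1 P)" for x
  proof -
    have "eq2 P (whisk p (whisk x ?h []) s) (whisk (p @ x) ?h s)"
      using eq2_whisk_whisk[OF h ps(1,2) that ps(4)] by simp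
    also have "eq2 P \<dots> (whisk (p @ x @ q) g s)"
      using eq2_whisk_whisk[OF g _ ps(2,3,4), of "p @ x"] ps(1) that by simp
    finally show ?thesis .
  qed
  have S: "{u, u', q @ v, q @ v'} \<subseteq> lists (cells1 P)" using uv by auto
  have "eq2 P (whisk (p @ u @ q) g s \<star>\<^sub>1 whisk p f (q @ v' @ s))
      (whisk p (whisk u ?h []) s \<star>\<^sub>1 whisk p (whisk [] f (q @ v')) s)"
    using eq2.sym[OF eq2.cong1[OF cell2_whisk[OF cg[OF uv(1)] ps(1,2)]
        cell2_whisk[OF cf[OF uv(4)] ps(1,2)] gg[OF uv(1)] ff[OF uv(4)]]] by simp
  also have "eq2 P \<dots> (whisk p (whisk u ?h [] \<star>\<^sub>1 whisk [] f (q @ v')) s)"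
    by (rule eq2.sym[OF eq2_whisk_comp1[OF cg cf ps(1,2)]]) (fact uv)+
  also have "eq2 P \<dots> (whisk p (f \<star>\<^sub>0 ?h) s)"
    by (rule eq2.cong0[OF eq2.refl[OF cell2.id[OF ps(1)]]
          eq2.cong0[OF eq2.sym[OF eq2_comp0_split(2)[OF f h S]] eq2.refl[OF cell2.id[OF ps(2)]]]])
  also have "eq2 P \<dots> (whisk p (whisk [] f (q @ v) \<star>\<^sub>1 whisk u' ?h []) s)"
    by (rule eq2.cong0[OF eq2.refl[OF cell2.id[OF ps(1)]]
          eq2.cong0[OF eq2_comp0_split(1)[OF f h S] eq2.refl[OF cell2.id[OF ps(2)]]]])
  also have "eq2 P \<dots> (whisk p (whisk [] f (q @ v)) s \<star>\<^sub>1 whisk p (whisk u' ?h []) s)"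
    by (rule eq2_whisk_comp1[OF cf cg ps(1,2)]) (fact uv)+
  also have "eq2 P \<dots> (whisk p f (q @ v @ s) \<star>\<^sub>1 whisk (p @ u' @ q) g s)"
    using eq2.cong1[OF cell2_whisk[OF cf[OF uv(3)] ps(1,2)]
        cell2_whisk[OF cg[OF uv(2)] ps(1,2)] ff[OF uv(3)] gg[OF uv(2)]] by simp
  finally show ?thesis .
qed

text \<open>Detaches the first part of a whiskered path, so that the rest, continued by
  \<open>h\<close>, can be replaced by a homotopic cell.\<close>

lemma htpy_whisk_comp1_assoc:
  assumes "cell2 P f u v" "cell2 P g v w" "cell2 P h (p @ w @ s) x"
    and ps: "p \<in> lists (cells1 P)" "s \<in> lists (cells1 P)"
  shows "htpy P (whisk p (f \<star>\<^sub>1 g) s \<star>\<^sub>1 h) (whisk p f s \<star>\<^sub>1 (whisk p g s \<star>\<^sub>1 h))"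
proof -
  note c = cell2_whisk[OF assms(1) ps] cell2_whisk[OF assms(2) ps] assms(3)
  note cfg = cell2_whisk[OF cell2.comp1[OF assms(1,2)] ps]
  have "htpy P (whisk p (f \<star>\<^sub>1 g) s \<star>\<^sub>1 h) ((whisk p f s \<star>\<^sub>1 whisk p g s) \<star>\<^sub>1 h)"
    by (rule htpy_comp1[OF htpy_eq2[OF eq2_whisk_comp1[OF assms(1,2) ps] cfg]
          htpy_refl[OF c(3)] cfg c(3)])
  also have "htpy P \<dots> (whisk p f s \<star>\<^sub>1 (whisk p g s \<star>\<^sub>1 h))"
    by (rule htpy_eq2[OF eq2.assoc1[OF c] cell2.comp1[OF cell2.comp1[OF c(1,2)] c(3)]])
  finally show ?thesis .
qed

lemma htpy_whisk_Id_comp1: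
  assumes "cell2 P h (p @ w @ s) x" "p \<in> lists (cells1 P)" "w \<in> lists (cells1 P)" "s \<in> lists (cells1 P)"
  shows "htpy P (whisk p (Id1 w) s \<star>\<^sub>1 h) h"
proof -
  note c = cell2_whisk[OF cell2.id[OF assms(3)] assms(2,4)]
  have "htpy P (whisk p (Id1 w) s \<star>\<^sub>1 h) (Id1 (p @ w @ s) \<star>\<^sub>1 h)"
    by (rule htpy_comp1[OF htpy_eq2[OF eq2_whisk_Id[OF assms(2-4)] c] htpy_refl[OF assms(1)] c assms(1)])
  also have "htpy P \<dots> h"
    by (rule htpy_eq2[OF eq2.unit1_left[OF assms(1)] cell2.comp1[OF cell2.id assms(1)]])
      (use assms in auto)
  finally show ?thesis .
qed

section \<open>Coherence from a choice of 2-cells to representatives, natural on generators\<close>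

locale contraction =
  fixes P :: "('a, 'b, 'c, 'z) polygraph31_scheme"
    and \<sigma> :: "'a list \<Rightarrow> ('a, 'b) term2"
    and nf :: "'a list \<Rightarrow> 'a list"
  assumes polygraph: "is_polygraph2 P"
    and cell2_\<sigma>: "w \<in> lists (cells1 P) \<Longrightarrow> cell2 P (\<sigma> w) w (nf w)"
    and step: "b \<in> cells2 P \<Longrightarrow> p \<in> lists (cells1 P) \<Longrightarrow> s \<in> lists (cells1 P) \<Longrightarrow>
      nf (p @ tgt2 P b @ s) = nf (p @ src2 P b @ s) \<and>
      htpy P (whisk p (Gen2 b) s \<star>\<^sub>1 \<sigma> (p @ tgt2 P b @ s)) (\<sigma> (p @ src2 P b @ s))"
begin

text \<open>Naturality of \<open>\<sigma>\<close> spreads from generating 2-cells to all 2-cells.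
  Contexts must be arbitrary in the induction, because each factor of a
  \<open>\<star>\<^sub>0\<close>-composite acts in a context formed by a boundary of the other. The
  equation for \<open>nf\<close> is carried along to keep the composites well typed.\<close>

lemma htpy_contract:
  assumes "cell2 P f u v" "p \<in> lists (cells1 P)" "s \<in> lists (cells1 P)"
  shows "nf (p @ v @ s) = nf (p @ u @ s) \<and>
    htpy P (whisk p f s \<star>\<^sub>1 \<sigma> (p @ v @ s)) (\<sigma> (p @ u @ s))"
  using assms
proof (induction arbitrary: p s)
  case (gen b)
  then show ?case by (rule step)
next
  case (id w)
  then have w: "p @ w @ s \<in> lists (cells1 P)" by auto
  note \<sigma> = cell2_\<sigma>[OF w]
  have "htpy P (whisk p (Id1 w) s \<star>\<^sub>1 \<sigma> (p @ w @ s)) (Id1 (p @ w @ s) \<star>\<^sub>1 \<sigma> (p @ w @ s))"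
    using id by (intro htpy_comp1[OF _ _ cell2_whisk[OF cell2.id] \<sigma>] htpy_refl[OF \<sigma>]
        htpy_eq2[OF eq2_whisk_Id cell2_whisk[OF cell2.id]])
  also have "htpy P \<dots> (\<sigma> (p @ w @ s))"
    by (rule htpy_eq2[OF eq2.unit1_left] cell2.comp1[OF cell2.id] \<sigma> w)+
  finally show ?case by simp
next
  case (comp0 f u v g u' v')
  note L = cell2_in_lists[OF polygraph comp0.hyps(1)] cell2_in_lists[OF polygraph comp0.hyps(2)]
  note ps = comp0.prems
  let ?\<sigma> = "\<sigma> (p @ (v @ v') @ s)"
  have g: "nf (p @ v @ v' @ s) = nf (p @ v @ u' @ s)"
    "htpy P (whisk (p @ v) g s \<star>\<^sub>1 ?\<sigma>) (\<sigma> (p @ v @ u' @ s))"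
    using comp0.IH(2)[of "p @ v" s] L ps by auto
  have f: "nf (p @ v @ u' @ s) = nf (p @ u @ u' @ s)"
    "htpy P (whisk p f (u' @ s) \<star>\<^sub>1 \<sigma> (p @ v @ u' @ s)) (\<sigma> (p @ u @ u' @ s))"
    using comp0.IH(1)[of p "u' @ s"] L ps by auto
  have c\<sigma>: "cell2 P ?\<sigma> (p @ (v @ v') @ s) (nf (p @ (v @ v') @ s))"
    using L ps by (intro cell2_\<sigma>) auto
  have cf: "cell2 P (whisk [] f u') (u @ u') (v @ u')"
    using cell2_whisk[OF comp0.hyps(1), of "[]" u'] L by simp
  have cg: "cell2 P (whisk v g []) (v @ u') (v @ v')"
    using cell2_whisk[OF comp0.hyps(2), of v "[]"] L by simp
  have cf': "cell2 P (whisk p f (u' @ s)) (p @ u @ u' @ s) (p @ v @ u' @ s)"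
    using cell2_whisk[OF comp0.hyps(1), of p "u' @ s"] L ps by simp
  have cg': "cell2 P (whisk (p @ v) g s) (p @ v @ u' @ s) (p @ (v @ v') @ s)"
    using cell2_whisk[OF comp0.hyps(2), of "p @ v" s] L ps by simp
  have "eq2 P (whisk p (f \<star>\<^sub>0 g) s) (whisk p (whisk [] f u' \<star>\<^sub>1 whisk v g []) s)"
    using L ps by (intro eq2.cong0 eq2_comp0_split[OF comp0.hyps] eq2.refl[OF cell2.id]) auto
  also have "eq2 P \<dots> (whisk p (whisk [] f u') s \<star>\<^sub>1 whisk p (whisk v g []) s)"
    by (rule eq2_whisk_comp1[OF cf cg ps])
  also have "eq2 P \<dots> (whisk p f (u' @ s) \<star>\<^sub>1 whisk (p @ v) g s)"
    using eq2_whisk_whisk[OF comp0.hyps(1), of p s "[]" u']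
      eq2_whisk_whisk[OF comp0.hyps(2), of p s v "[]"] L ps
    by (intro eq2.cong1[OF cell2_whisk[OF cf ps] cell2_whisk[OF cg ps]]) auto
  finally have "eq2 P (whisk p (f \<star>\<^sub>0 g) s) \<dots>" .
  with c\<sigma> have "htpy P (whisk p (f \<star>\<^sub>0 g) s \<star>\<^sub>1 ?\<sigma>) ((whisk p f (u' @ s) \<star>\<^sub>1 whisk (p @ v) g s) \<star>\<^sub>1 ?\<sigma>)"
    by (meson cell2.comp0 cell2_whisk comp0.hyps htpy_comp1 htpy_eq2 htpy_refl ps)
  also have "htpy P \<dots> (whisk p f (u' @ s) \<star>\<^sub>1 (whisk (p @ v) g s \<star>\<^sub>1 ?\<sigma>))"
    by (rule htpy_eq2[OF eq2.assoc1] cf' cg' c\<sigma> cell2.comp1)+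
  also have "htpy P \<dots> (whisk p f (u' @ s) \<star>\<^sub>1 \<sigma> (p @ v @ u' @ s))"
    by (rule htpy_comp1 htpy_refl cf' cg' c\<sigma> cell2.comp1 g)+
  also have "htpy P \<dots> (\<sigma> (p @ u @ u' @ s))" by (rule f)
  finally show ?case using f g by simp
next
  case (comp1 f u v g w)
  note ps = comp1.prems
  note L = cell2_in_lists[OF polygraph comp1.hyps(1)] cell2_in_lists[OF polygraph comp1.hyps(2)]
  note f = comp1.IH(1)[OF ps] and g = comp1.IH(2)[OF ps]
  note cf = cell2_whisk[OF comp1.hyps(1) ps] and cg = cell2_whisk[OF comp1.hyps(2) ps]
  let ?\<sigma> = "\<sigma> (p @ w @ s)"
  have c\<sigma>: "cell2 P ?\<sigma> (p @ w @ s) (nf (p @ w @ s))"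
    using L ps by (intro cell2_\<sigma>) auto
  have "htpy P (whisk p (f \<star>\<^sub>1 g) s \<star>\<^sub>1 ?\<sigma>) ((whisk p f s \<star>\<^sub>1 whisk p g s) \<star>\<^sub>1 ?\<sigma>)"
    using eq2_whisk_comp1[OF comp1.hyps ps] c\<sigma>
    by (meson cell2.comp1 cell2_whisk comp1.hyps htpy_comp1 htpy_eq2 htpy_refl ps)
  also have "htpy P \<dots> (whisk p f s \<star>\<^sub>1 (whisk p g s \<star>\<^sub>1 ?\<sigma>))"
    by (rule htpy_eq2[OF eq2.assoc1] cf cg c\<sigma> cell2.comp1)+
  also have "htpy P \<dots> (whisk p f s \<star>\<^sub>1 \<sigma> (p @ v @ s))"
    by (rule htpy_comp1 htpy_refl cf cg c\<sigma> cell2.comp1 g[THEN conjunct2])+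
  also have "htpy P \<dots> (\<sigma> (p @ u @ s))" using f by simp
  finally show ?case using f g by simp
next
  case (inv f u v)
  note ps = inv.prems
  note L = cell2_in_lists[OF polygraph inv.hyps]
  note f = inv.IH[OF ps]
  note cf = cell2_whisk[OF inv.hyps ps] and ci = cell2_whisk[OF cell2.inv[OF inv.hyps] ps]
  let ?\<sigma> = "\<sigma> (p @ v @ s)"
  have c\<sigma>: "cell2 P ?\<sigma> (p @ v @ s) (nf (p @ v @ s))"
    using L ps by (intro cell2_\<sigma>) auto
  have c\<sigma>': "cell2 P (\<sigma> (p @ u @ s)) (p @ u @ s) (nf (p @ u @ s))"
    using L ps by (intro cell2_\<sigma>) auto
  have "eq2 P (whisk p (Inv1 f) s \<star>\<^sub>1 whisk p f s) (whisk p (Inv1 f \<star>\<^sub>1 f) s)"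
    by (rule eq2.sym[OF eq2_whisk_comp1] cell2.inv inv.hyps ps)+
  also have "eq2 P \<dots> (whisk p (Id1 v) s)"
    by (intro eq2.cong0 eq2.refl[OF cell2.id] ps eq2.inv_left[OF inv.hyps])
  also have "eq2 P \<dots> (Id1 (p @ v @ s))"
    by (rule eq2_whisk_Id) (use L ps in auto)
  finally have inv_eq: "eq2 P (whisk p (Inv1 f) s \<star>\<^sub>1 whisk p f s) (Id1 (p @ v @ s))" .
  \<comment> \<open>Naturality for \<open>f\<close> is read backwards: it expands
    \<open>\<sigma>\<close> at the source of \<open>f\<close> so that \<open>f\<close> appears and
    cancels against its inverse.\<close>
  have "htpy P (whisk p (Inv1 f) s \<star>\<^sub>1 \<sigma> (p @ u @ s)) (whisk p (Inv1 f) s \<star>\<^sub>1 (whisk p f s \<star>\<^sub>1 ?\<sigma>))"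
    by (rule htpy_comp1 htpy_refl cf ci c\<sigma> cell2.comp1 htpy_sym[OF f[THEN conjunct2]]
        c\<sigma>')+
  also have "htpy P \<dots> ((whisk p (Inv1 f) s \<star>\<^sub>1 whisk p f s) \<star>\<^sub>1 ?\<sigma>)"
    by (rule htpy_eq2'[OF eq2.assoc1] cf ci c\<sigma> cell2.comp1)+
  also have "htpy P \<dots> (Id1 (p @ v @ s) \<star>\<^sub>1 ?\<sigma>)"
    by (rule htpy_comp1 htpy_eq2[OF inv_eq] htpy_refl cf ci c\<sigma> cell2.comp1)+
  also have "htpy P \<dots> ?\<sigma>"
    by (rule htpy_eq2[OF eq2.unit1_left[OF c\<sigma>] cell2.comp1[OF cell2.id c\<sigma>]]) (use L ps in auto)
  finally show ?case using f by simp
qed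

lemma htpy_normalized:
  assumes f: "cell2 P f u v"
  shows "htpy P f (\<sigma> u \<star>\<^sub>1 Inv1 (\<sigma> v))"
proof -
  note L = cell2_in_lists[OF polygraph f]
  have nf: "nf v = nf u" and H: "htpy P (whisk [] f [] \<star>\<^sub>1 \<sigma> v) (\<sigma> u)"
    using htpy_contract[OF f, of "[]" "[]"] by auto
  have cu: "cell2 P (\<sigma> u) u (nf u)" and cv: "cell2 P (\<sigma> v) v (nf u)"
    using cell2_\<sigma>[of u] cell2_\<sigma>[of v] L nf by auto
  have cw: "cell2 P (whisk [] f []) u v"
    using cell2_whisk[OF f, of "[]" "[]"] by simp
  have "htpy P f (f \<star>\<^sub>1 Id1 v)"
    by (rule htpy_eq2'[OF eq2.unit1_right] f)+
  also have "htpy P \<dots> (f \<star>\<^sub>1 (\<sigma> v \<star>\<^sub>1 Inv1 (\<sigma> v)))"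
    using L by (intro htpy_comp1[OF _ _ f cell2.id] htpy_refl[OF f] htpy_eq2'[OF eq2.inv_right])
      (auto intro: cv cell2.comp1 cell2.inv cell2.id htpy_eq2 eq2.sym eq2.inv_right)
  also have "htpy P \<dots> ((f \<star>\<^sub>1 \<sigma> v) \<star>\<^sub>1 Inv1 (\<sigma> v))"
    by (rule htpy_eq2'[OF eq2.assoc1] cell2.comp1 cell2.inv f cv)+
  also have "htpy P \<dots> ((whisk [] f [] \<star>\<^sub>1 \<sigma> v) \<star>\<^sub>1 Inv1 (\<sigma> v))"
    by (rule htpy_comp1 htpy_refl[OF cell2.inv] htpy_refl[OF cv] htpy_eq2'[OF eq2_whisk_Nil] cell2.comp1 cell2.inv f cv)+
  also have "htpy P \<dots> (\<sigma> u \<star>\<^sub>1 Inv1 (\<sigma> v))"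
    by (rule htpy_comp1 H htpy_refl[OF cell2.inv] cw cell2.comp1 cell2.inv f cv)+
  finally show ?thesis .
qed

lemma homotopy_basis: "homotopy_basis P"
  by (intro homotopy_basisI) (blast intro: htpy_normalized htpy_trans htpy_sym)

end

section \<open>Right N-insertion and the stylic congruence\<close>

text \<open>A list of length at most one, so that the passage to the rows above is a
  \<open>fold N_insert\<close> whether or not a letter is bumped.\<close>

definition next_above :: "nat set \<Rightarrow> nat \<Rightarrow> nat list" where
  "next_above U x = (if \<exists>y\<in>U. x < y then [Min {y \<in> U. x < y}] else [])"

fun bumps :: "nat set \<Rightarrow> nat list \<Rightarrow> nat list" where
  "bumps U [] = []"
| "bumps U (x # w) = next_above U x @ bumps (insert x U) w"

lemma next_above_eq_Nil_iff: "next_above U x = [] \<longleftrightarrow> (\<forall>y\<in>U. y \<le> x)"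
  by (auto simp: next_above_def not_less simp flip: not_le)

lemma next_above_eqI:
  assumes "m \<in> U" "x < m" "\<And>y. y \<in> U \<Longrightarrow> x < y \<Longrightarrow> m \<le> y" "finite U"
  shows "next_above U x = [m]"
proof -
  have "Min {y \<in> U. x < y} = m"
    using assms by (intro Min_eqI) auto
  with assms show ?thesis by (auto simp: next_above_def)
qed

lemma next_above_cases:
  assumes "finite U"
  obtains (none) "next_above U x = []" "\<forall>y\<in>U. y \<le> x"
  | (some) m where "next_above U x = [m]" "m \<in> U" "x < m" "\<forall>y\<in>U. x < y \<longrightarrow> m \<le> y"
proof (cases "\<exists>y\<in>U. x < y")
  case True
  have "finite {y \<in> U. x < y}" "{y \<in> U. x < y} \<noteq> {}" using assms True by auto
  from Min_in[OF this] Min_le[OF this(1)] True show ?thesis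
    by (intro some[of "Min {y \<in> U. x < y}"]) (auto simp: next_above_def)
next
  case False
  then show ?thesis by (intro none) (auto simp: next_above_def not_less)
qed

lemma next_above_insert_le: "x \<le> z \<Longrightarrow> next_above (insert x U) z = next_above U z"
  unfolding next_above_def by (rule if_cong) (auto intro!: arg_cong[of _ _ Min])

lemma N_insert_Cons:
  "N_insert x (u # T) =
    sorted_list_of_set (insert x (set u)) # fold N_insert (next_above (set u) x) T"
  by (simp add: next_above_def)

text \<open>Insertion of a word splits into its effect on the bottom row and the insertion of the
  bumped word above. Equality of two insertions can thus be proved by induction on the tableau,
  comparing bumped words only. The word is nonempty because it is an insertion that sorts the
  row.\<close>

lemma fold_N_insert_Cons:
  "w \<noteq> [] \<Longrightarrow> fold N_insert w (u # T) =
    sorted_list_of_set (set u \<union> set w) # fold N_insert (bumps (set u) w) T"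
proof (induction w arbitrary: u T)
  case (Cons x w)
  show ?case
  proof (cases "w = []")
    case True
    then show ?thesis by (simp add: N_insert_Cons del: N_insert.simps)
  next
    case False
    then show ?thesis by (simp add: N_insert_Cons Cons.IH del: N_insert.simps)
  qed
qed simp

text \<open>The empty tableau behaves like an empty bottom row.\<close>

lemma fold_N_insert_Nil:
  "w \<noteq> [] \<Longrightarrow> fold N_insert w [] =
    sorted_list_of_set (set w) # fold N_insert (bumps {} w) []"
proof (cases w)
  case (Cons x w')
  then show ?thesis
    by (cases "w' = []") (simp_all add: fold_N_insert_Cons next_above_def)
qed simp

section \<open>Invariance of insertion under the stylic relations\<close>

lemma N_insert_idem: "N_insert x (N_insert x T) = N_insert x T"
proof (induction T arbitrary: x)
  case Nil
  then show ?case by simp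
next
  case (Cons u T)
  \<comment> \<open>The copy of \<open>x\<close> just inserted is not above \<open>x\<close>, so the
    second insertion bumps the same letter as the first.\<close>
  have eq: "next_above (insert x (set u)) x = next_above (set u) x"
    by (rule next_above_insert_le) simp
  have "finite (set u)" by simp
  then show ?case
    by (cases rule: next_above_cases[where x = x])
      (auto simp: N_insert_Cons eq Cons.IH simp del: N_insert.simps)
qed

text \<open>Let b be the letter bumped by \<open>z\<close>, possibly absent. If the row has a letter
  in the interval from \<open>x\<close> (excluded) to \<open>z\<close> (included), the bumped words
  are b m k and m b k with m \<le> k \<le> z < b, an instance of the same relation one row up.
  Otherwise \<open>x\<close> and \<open>y\<close> bump the \<open>z\<close> just inserted, while
  \<open>x\<close> inserted before \<open>z\<close> bumps b: the words b z z and b b z agree by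
  idempotence.\<close>

lemma fold_N_insert_zxy:
  "x \<le> y \<Longrightarrow> y < z \<Longrightarrow> fold N_insert [z, x, y] T = fold N_insert [x, z, y] T"
proof (induction T arbitrary: x y z)
  case Nil
  then show ?case
    using N_insert_idem[of z "[]"]
    by (auto simp: fold_N_insert_Nil next_above_def not_less insert_commute simp del: fold.simps)
      (auto simp: Collect_conv_if insert_commute conj_disj_distribR Collect_disj_eq)
next
  case (Cons u T)
  let ?U = "set u"
  have fin: "finite ?U" by simp
  have e1: "next_above (insert x (insert z ?U)) y = next_above (insert z ?U) y"
    "next_above (insert z (insert x ?U)) y = next_above (insert z ?U) y"
    using Cons.prems by (simp_all add: next_above_insert_le insert_commute[of z x])
  have e2: "next_above (insert x ?U) z = next_above ?U z"
    using Cons.prems by (simp add: next_above_insert_le)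
  have "fold N_insert (next_above ?U z @ next_above (insert z ?U) x @ next_above (insert z ?U) y) T =
    fold N_insert (next_above ?U x @ next_above ?U z @ next_above (insert z ?U) y) T"
  proof (cases "\<exists>a\<in>?U. x < a \<and> a \<le> z")
    case False
    then have "next_above (insert z ?U) x = [z]" "next_above (insert z ?U) y = [z]"
      using Cons.prems by (auto intro!: next_above_eqI)
    moreover have "next_above ?U x = next_above ?U z"
    proof -
      have "{a\<in>?U. x < a} = {a\<in>?U. z < a}" using False Cons.prems by auto
      moreover from this have "(\<exists>a\<in>?U. x < a) \<longleftrightarrow> (\<exists>a\<in>?U. z < a)" by blast
      ultimately show ?thesis by (simp add: next_above_def)
    qed
    ultimately show ?thesis
      by (cases rule: next_above_cases[OF fin, of z]) (simp_all add: N_insert_idem)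
  next
    case True
    then obtain a where a: "a \<in> ?U" "x < a" "a \<le> z" by blast
    obtain m where m: "next_above ?U x = [m]" "m \<in> ?U" "x < m" "\<forall>y\<in>?U. x < y \<longrightarrow> m \<le> y"
      by (rule next_above_cases[OF fin, of x]) (use a in auto)
    have m': "next_above (insert z ?U) x = [m]"
      using m a by (intro next_above_eqI) (auto intro: order_trans)
    obtain k where k: "next_above (insert z ?U) y = [k]" "k \<in> insert z ?U" "y < k"
      "\<forall>a\<in>insert z ?U. y < a \<longrightarrow> k \<le> a"
      by (rule next_above_cases[of "insert z ?U" y]) (use Cons.prems in auto)
    have "m \<le> k" "k \<le> z" using k m m' a Cons.prems by (auto intro: order_trans)
    with Cons.IH[of m k] show ?thesis
      by (cases rule: next_above_cases[OF fin, of z]) (auto simp: m m' k)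
  qed
  then show ?case
    by (simp add: fold_N_insert_Cons e1 e2 insert_commute[of z x] del: fold.simps)
qed

text \<open>Once \<open>y\<close> is in the row, \<open>x\<close> bumps some m \<le> y in either
  order. If \<open>z\<close> bumps z', then \<open>y\<close> bumps some y' with m < y' \<le> z', and
  the bumped words y' z' m and y' m z' are an instance of the same relation one row up. If
  \<open>z\<close> bumps nothing, the bumped words are equal.\<close>

lemma fold_N_insert_yzx:
  "x < y \<Longrightarrow> y \<le> z \<Longrightarrow> fold N_insert [y, z, x] T = fold N_insert [y, x, z] T"
proof (induction T arbitrary: x y z)
  case Nil
  have "next_above {y, z} x = [y]" "next_above {y} x = [y]" "next_above {y} z = []"
     "next_above {x, y} z = []" "next_above {} y = []" "{x,y,z} = {y,z,x}"
    using Nil by (auto intro!: next_above_eqI simp: next_above_eq_Nil_iff)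
  then show ?case
    by (auto simp: fold_N_insert_Nil insert_commute simp del: fold.simps)
next
  case (Cons u T)
  note IH = Cons.IH
  let ?U = "set u"
  have fin: "finite ?U" by simp
  obtain m where m: "next_above (insert y ?U) x = [m]" "m \<in> insert y ?U" "x < m"
      "\<forall>a\<in>insert y ?U. x < a \<longrightarrow> m \<le> a"
      by (rule next_above_cases[of "insert y ?U" x]) (use Cons.prems in auto)
  have xy: "x < y" "y \<le> z" "m \<le> y" using m Cons.prems by auto
  have m': "next_above (insert z (insert y ?U)) x = [m]"
    using m xy by (intro next_above_eqI) auto
  have e: "next_above (insert y ?U) z = next_above ?U z"
    "next_above (insert x (insert y ?U)) z = next_above ?U z"
    using Cons.prems by (simp_all add: next_above_insert_le)
  have "fold N_insert (next_above ?U y @ next_above ?U z @ [m]) T =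
    fold N_insert (next_above ?U y @ [m] @ next_above ?U z) T"
    using fin
  proof (cases rule: next_above_cases[where x = z])
    case none
    then show ?thesis by simp
  next
    case (some z')
    obtain y' where y': "next_above ?U y = [y']" "y < y'" "y' \<le> z'"
      by (rule next_above_cases[OF fin, of y]) (use some(2,3) xy in \<open>auto dest: bspec[of _ _ z']\<close>)
    with IH[of m y' z'] xy some(1) y' show ?thesis by simp
  qed
  then show ?case
    by (simp add: fold_N_insert_Cons e m m' insert_commute[of x z] del: fold.simps)
qed


abbreviation styl_cong :: "nat \<Rightarrow> nat list rel" where
  "styl_cong n \<equiv> word_cong {1..n} (stylic_relations n)"

lemma fold_N_insert_cong:
  "(w, w') \<in> styl_cong n \<Longrightarrow> fold N_insert w T = fold N_insert w' T"
proof (induction arbitrary: T rule: word_cong.induct)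
  case (base u v p s)
  have "fold N_insert u T = fold N_insert v T" for T
    using base(1) fold_N_insert_zxy fold_N_insert_yzx
    by (auto simp: stylic_relations_def N_insert_idem simp del: fold.simps)
      (auto simp: N_insert_idem)
  then show ?case by simp
qed auto

lemma N_tab_cong:
  "(w, w') \<in> styl_cong n \<Longrightarrow> N_tab w = N_tab w'"
  unfolding N_tab_def by (rule fold_N_insert_cong)

section \<open>Congruence of a word with the reading of its tableau\<close>

lemma styl_cong_rel:
  assumes "(u, v) \<in> stylic_relations n" "p \<in> lists {1..n}" "s \<in> lists {1..n}"
  shows "(p @ u @ s, p @ v @ s) \<in> styl_cong n"
  using assms by (intro word_cong.base) (auto simp: stylic_relations_def)

lemma styl_cong_idem: "x \<in> {1..n} \<Longrightarrow> p \<in> lists {1..n} \<Longrightarrow> s \<in> lists {1..n} \<Longrightarrow>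
    (p @ x # x # s, p @ x # s) \<in> styl_cong n"
  using styl_cong_rel[of "[x,x]" "[x]" n p s] by (auto simp: stylic_relations_def)

text \<open>To pass a letter y, \<open>x\<close> uses the left neighbour q of y: q y x = q x y, as x
  < q \<le> y. The leading \<open>z\<close> is the last such neighbour and stays in place. Only weak
  sortedness is asked, since the word will begin with a duplicated letter.\<close>

lemma styl_cong_move_left:
  assumes "x < z" "sorted (z # b)" "set (x # z # b) \<subseteq> {1..n}"
  shows "(z # b @ [x], z # x # b) \<in> styl_cong n"
  using assms
proof (induction b rule: rev_induct)
  case Nil
  then have "[z, x] \<in> lists {1..n}" by auto
  then show ?case by (auto intro: word_cong.refl)
next
  case (snoc y b)
  define q where "q = last (z # b)"
  define r where "r = butlast (z # b)"
  have zb: "z # b = r @ [q]" by (simp add: q_def r_def)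
  have "q \<in> set (z # b)" "set r \<subseteq> set (z # b)" by (auto simp: zb)
  then have q: "z \<le> q" "q \<le> y" "q \<in> {1..n}" "r \<in> lists {1..n}"
    using snoc.prems by (auto simp: sorted_append subset_iff)
  have "(r @ [q, y, x] @ [], r @ [q, x, y] @ []) \<in> styl_cong n"
    using q snoc.prems by (intro styl_cong_rel) (auto simp: stylic_relations_def)
  then have "((z # b) @ [y, x], (z # b) @ [x, y]) \<in> styl_cong n" by (simp add: zb)
  moreover have "((z # b @ [x]) @ [y], (z # x # b) @ [y]) \<in> styl_cong n"
    using snoc word_cong_append[of "z # b @ [x]" "z # x # b" "{1..n}" _ "[]" "[y]"]
    by (auto simp: sorted_append)
  ultimately show ?case by (auto intro: word_cong.trans)
qed

text \<open>The letter \<open>z\<close> passes y by y z x = z y x, where y \<le> x < z and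
  \<open>x\<close> stands to the right as a witness. Afterwards y is the witness for passing the
  letter before it.\<close>

lemma styl_cong_move_front:
  assumes "\<forall>y\<in>set (a @ [x]). y < z" "sorted a" "\<forall>y\<in>set a. y \<le> x" "set (a @ [x, z]) \<subseteq> {1..n}"
  shows "(a @ [z, x], z # a @ [x]) \<in> styl_cong n"
  using assms
proof (induction a arbitrary: x rule: rev_induct)
  case Nil
  then have "[z, x] \<in> lists {1..n}" by auto
  then show ?case by (auto intro: word_cong.refl)
next
  case (snoc y a)
  have "(a @ [y, z, x] @ [], a @ [z, y, x] @ []) \<in> styl_cong n"
    using snoc.prems by (intro word_cong.sym[OF styl_cong_rel]) (auto simp: stylic_relations_def)
  then have "((a @ [y]) @ [z, x], (a @ [z, y]) @ [x]) \<in> styl_cong n" by simp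
  moreover have "((a @ [z, y]) @ [x], (z # a @ [y]) @ [x]) \<in> styl_cong n"
    using snoc word_cong_append[of "a @ [z, y]" "z # a @ [y]" "{1..n}" _ "[]" "[x]"]
    by (auto simp: sorted_append)
  ultimately show ?case by (auto intro: word_cong.trans)
qed

lemma sorted_list_of_set_eqI: "sorted_wrt (<) w \<Longrightarrow> sorted_list_of_set (set w) = w"
  by (simp add: sorted_list_of_set.idem_if_sorted_distinct strict_sorted_iff)

text \<open>
  Write a row as \<open>a @ y # b\<close> with \<open>y\<close> its least letter above \<open>x\<close>. Duplicate \<open>y\<close>.
  A letter \<open>x\<close> appended to the row moves left past \<open>y # b\<close> thanks to the first \<open>y\<close>, and then this \<open>y\<close> moves left past \<open>a\<close> thanks to \<open>x\<close>.
\<close>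

lemma styl_cong_bump:
  assumes u: "sorted_wrt (<) u" "set u \<subseteq> {1..n}" and x: "x \<in> {1..n}"
  shows "(u @ [x], next_above (set u) x @ sorted_list_of_set (insert x (set u))) \<in> styl_cong n"
proof -
  define a where "a = filter (\<lambda>y. y < x) u"
  define b where "b = filter (\<lambda>y. x < y) u"
  \<comment> \<open>A copy of \<open>x\<close> already in the row sits between \<open>a\<close> and
    \<open>b\<close>. It stays next to \<open>a\<close> until it merges with the new
    \<open>x\<close> by idempotence.\<close>
  define m where "m = filter (\<lambda>y. y = x) u"
  have m_eq: "m = [x] \<or> m = [] \<and> x \<notin> set u"
    using u(1) unfolding m_def by (induction u) (auto simp: filter_empty_conv)
  have su: "u = sorted_list_of_set (set u)"
    using u by (simp add: sorted_list_of_set_eqI)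
  have s: "sorted_wrt (<) a" "sorted_wrt (<) b"
    using u by (simp_all add: a_def b_def sorted_wrt_filter)
  have lt: "\<And>y. y \<in> set a \<Longrightarrow> y < x" "\<And>y. y \<in> set b \<Longrightarrow> x < y"
    by (simp_all add: a_def b_def)
  have m: "set m \<subseteq> {x}" "sorted_wrt (<) m"
    using m_eq by auto
  have "sorted_wrt (<) (a @ m @ b)"
    using s lt m unfolding sorted_wrt_append by (auto intro: less_trans)
  moreover have "set (a @ m @ b) = set u"
    by (auto simp: a_def b_def m_def)
  ultimately have u_eq: "u = a @ m @ b" using su sorted_list_of_set_eqI by metis
  have "sorted_wrt (<) (a @ x # b)"
    using s lt by (auto simp: sorted_wrt_append intro: less_trans)
  moreover have "set (a @ x # b) = insert x (set u)"
    by (auto simp: a_def b_def)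
  ultimately have u'_eq: "sorted_list_of_set (insert x (set u)) = a @ x # b"
    by (metis sorted_list_of_set_eqI)
  have L: "a \<in> lists {1..n}" "b \<in> lists {1..n}" "m \<in> lists {1..n}" "[x] \<in> lists {1..n}"
    using u x by (auto simp: a_def b_def m_def)
  have mx: "(p @ m @ x # q, p @ x # q) \<in> styl_cong n"
    if "p \<in> lists {1..n}" "q \<in> lists {1..n}" for p q
    using m_eq that L styl_cong_idem[OF x that] by (auto intro!: word_cong.refl)
  show ?thesis
  proof (cases b)
    case Nil
    then have "next_above (set u) x = []"
      by (auto simp: next_above_eq_Nil_iff b_def filter_empty_conv not_less)
    then show ?thesis using mx[of a "[]"] L Nil u'_eq u_eq by simp
  next
    case (Cons y c)
    have y: "next_above (set u) x = [y]"
    proof (rule next_above_eqI)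
      fix z assume "z \<in> set u" "x < z"
      then have "z \<in> set b" by (simp add: b_def)
      then show "y \<le> z" using Cons s by auto
    qed (use Cons in \<open>auto simp: b_def filter_eq_Cons_iff\<close>)
    have yc: "y \<in> {1..n}" "c \<in> lists {1..n}" "x < y"
      using L Cons by (auto simp: b_def filter_eq_Cons_iff)
    have "((a @ m) @ y # c @ [x], (a @ m) @ y # (y # c) @ [x]) \<in> styl_cong n"
      using word_cong.sym[OF styl_cong_idem[of y n "a @ m" "c @ [x]"]] L yc by auto
    moreover have "((a @ m) @ (y # (y # c) @ [x]) @ [], (a @ m) @ (y # x # y # c) @ []) \<in> styl_cong n"
      using s L yc
      by (intro word_cong_append styl_cong_move_left) (auto simp: Cons strict_sorted_iff)
    ultimately have "((a @ m) @ y # c @ [x], (a @ m) @ y # x # y # c) \<in> styl_cong n"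
      by (auto intro: word_cong.trans)
    then have "(u @ [x], (a @ m) @ y # x # y # c) \<in> styl_cong n" by (simp add: u_eq Cons)
    also have "([] @ ((a @ m) @ [y, x]) @ y # c, [] @ (y # (a @ m) @ [x]) @ y # c) \<in> styl_cong n"
    proof (intro word_cong_append styl_cong_move_front)
      show "\<forall>z\<in>set ((a @ m) @ [x]). z < y" "\<forall>z\<in>set (a @ m). z \<le> x"
        using lt m yc by fastforce+
      show "sorted (a @ m)"
        using s m lt by (auto simp: strict_sorted_iff sorted_append less_imp_le)
      show "set ((a @ m) @ [x, y]) \<subseteq> {1..n}"
        using L x yc by auto
    qed (use yc in auto)
    then have "((a @ m) @ y # x # y # c, (y # a) @ m @ x # y # c) \<in> styl_cong n" by simp
    also have "((y # a) @ m @ x # y # c, (y # a) @ x # y # c) \<in> styl_cong n"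
      using L yc by (intro mx) auto
    finally show ?thesis by (simp add: y u'_eq Cons)
  qed
qed


lemma styl_cong_insert:
  assumes "\<forall>u\<in>set T. sorted_wrt (<) u \<and> set u \<subseteq> {1..n}" "x \<in> {1..n}"
  shows "(concat (rev T) @ [x], concat (rev (N_insert x T))) \<in> styl_cong n"
  using assms
proof (induction T arbitrary: x)
  case Nil
  then have "[x] \<in> lists {1..n}" by auto
  then show ?case by (auto intro: word_cong.refl)
next
  case (Cons u T)
  let ?u' = "sorted_list_of_set (insert x (set u))"
  have L: "concat (rev T) \<in> lists {1..n}" "?u' \<in> lists {1..n}"
    using Cons.prems by fastforce+
  have "(concat (rev T) @ (u @ [x]) @ [], concat (rev T) @ (next_above (set u) x @ ?u') @ [])
      \<in> styl_cong n"
    using Cons.prems L by (intro word_cong_append styl_cong_bump) auto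
  moreover have "(concat (rev T) @ next_above (set u) x @ ?u',
      concat (rev (fold N_insert (next_above (set u) x) T)) @ ?u') \<in> styl_cong n"
    using finite_set[of u]
  proof (cases rule: next_above_cases[where x = x])
    case none
    then show ?thesis using L by (auto intro!: word_cong.refl)
  next
    case (some y)
    then have "y \<in> {1..n}" using Cons.prems by auto
    with Cons have "(concat (rev T) @ [y], concat (rev (N_insert y T))) \<in> styl_cong n"
      by simp
    then have "([] @ (concat (rev T) @ [y]) @ ?u', [] @ concat (rev (N_insert y T)) @ ?u') \<in> styl_cong n"
      using L by (intro word_cong_append) auto
    then show ?thesis by (simp add: some(1))
  qed
  ultimately show ?case
    by (auto simp: N_insert_Cons intro: word_cong.trans simp del: N_insert.simps)
qed

text \<open>A tableau in the order of \<open>N_tab\<close>, that is, from bottom to top.\<close>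

definition tableau :: "nat \<Rightarrow> row list \<Rightarrow> bool" where
  "tableau n T \<longleftrightarrow> set T \<subseteq> rows n \<and> successively (\<lambda>u v. v \<triangleleft> u) T"

lemma tableau_Nil [simp]: "tableau n []"
  by (simp add: tableau_def)

lemma tableau_Cons: "tableau n (u # T) \<longleftrightarrow> u \<in> rows n \<and> tableau n T \<and> (T = [] \<or> hd T \<triangleleft> u)"
  by (cases T) (auto simp: tableau_def)

lemma sorted_list_in_rows:
  "A \<subseteq> {1..n} \<Longrightarrow> A \<noteq> {} \<Longrightarrow> sorted_list_of_set A \<in> rows n"
  using finite_subset[of A "{1..n}"] by (auto simp: rows_def)

lemma N_insert_not_Nil [simp]: "N_insert x T \<noteq> []"
  by (cases T) auto

lemma set_hd_N_insert:
  "set (hd (N_insert x T)) = insert x (if T = [] then {} else set (hd T))"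
  by (cases T) auto

text \<open>The minimum of the new bottom row is at most \<open>x\<close> and at most the old
  minimum, hence smaller than the bumped letter and than the row above; the bumped letter stays in
  the row, which gives the inclusion.\<close>

lemma tableau_N_insert:
  assumes "tableau n T" "x \<in> {1..n}"
  shows "tableau n (N_insert x T)"
  using assms
proof (induction T arbitrary: x)
  case Nil
  then show ?case by (auto simp: tableau_Cons rows_def)
next
  case (Cons u T)
  have u: "u \<in> rows n" "tableau n T" "T = [] \<or> hd T \<triangleleft> u"
    using Cons.prems by (auto simp: tableau_Cons)
  then have ne: "set u \<noteq> {}" "set u \<subseteq> {1..n}" by (auto simp: rows_def)
  have u': "sorted_list_of_set (insert x (set u)) \<in> rows n"
    using ne Cons.prems by (intro sorted_list_in_rows) auto
  have hd_T: "set (hd T) \<subseteq> set u" "set (hd T) \<noteq> {}" "Min (set u) < Min (set (hd T))" if "T \<noteq> []"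
    using u(2,3) that by (cases T; auto simp: row_rel_def tableau_Cons rows_def)+
  show ?case
    using finite_set[of u]
  proof (cases rule: next_above_cases[where x = x])
    case none
    have "hd T \<triangleleft> sorted_list_of_set (insert x (set u))" if "T \<noteq> []"
    proof -
      have "Min (insert x (set u)) \<le> Min (set u)" using ne by (intro Min_antimono) auto
      then show ?thesis using hd_T[OF that] by (auto simp: row_rel_def simp del: Min_gr_iff)
    qed
    with none u' u show ?thesis
      by (auto simp: N_insert_Cons tableau_Cons simp del: N_insert.simps)
  next
    case (some y)
    have y: "y \<in> {1..n}" using some ne by auto
    let ?m = "Min (insert x (set u))"
    have "?m < y" using some by (intro le_less_trans[OF Min_le[of _ x]]) auto
    moreover have "?m < a" if "T \<noteq> []" "a \<in> set (hd T)" for a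
    proof -
      have "?m \<le> Min (set u)" using ne by (intro Min_antimono) auto
      also have "Min (set u) < Min (set (hd T))" by (rule hd_T) fact
      also have "Min (set (hd T)) \<le> a" using that by simp
      finally show ?thesis .
    qed
    ultimately have "hd (N_insert y T) \<triangleleft> sorted_list_of_set (insert x (set u))"
      using some(2) hd_T(1) by (auto simp: row_rel_def set_hd_N_insert simp del: Min_insert)
    with some(1) u' u(2) Cons.IH[OF u(2) y] show ?thesis
      by (auto simp: N_insert_Cons tableau_Cons simp del: N_insert.simps)
  qed
qed

lemma tableau_fold_N_insert:
  "w \<in> lists {1..n} \<Longrightarrow> tableau n T \<Longrightarrow> tableau n (fold N_insert w T)"
  by (induction w arbitrary: T) (auto simp: tableau_N_insert simp del: N_insert.simps One_nat_def)

lemma tableau_N_tab: "w \<in> lists {1..n} \<Longrightarrow> tableau n (N_tab w)"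
  by (simp add: N_tab_def tableau_fold_N_insert)

lemma styl_cong_reading: "w \<in> lists {1..n} \<Longrightarrow> (w, concat (reading (N_tab w))) \<in> styl_cong n"
proof (induction w rule: rev_induct)
  case Nil
  then show ?case by (auto simp: N_tab_def reading_def intro: word_cong.refl)
next
  case (snoc x w)
  have "(w @ [x], concat (reading (N_tab w)) @ [x]) \<in> styl_cong n"
    using word_cong_append[of w _ "{1..n}" _ "[]" "[x]"] snoc by auto
  also have "(concat (reading (N_tab w)) @ [x], concat (rev (N_insert x (N_tab w)))) \<in> styl_cong n"
    unfolding reading_def
    using tableau_N_tab[of w n] snoc.prems
    by (intro styl_cong_insert) (auto simp: tableau_def rows_def)
  finally show ?case by (simp add: N_tab_def reading_def)
qed

lemma styl_cong_iff:
  assumes "w \<in> lists {1..n}" "w' \<in> lists {1..n}"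
  shows "(w, w') \<in> styl_cong n \<longleftrightarrow> N_tab w = N_tab w'"
  using assms styl_cong_reading N_tab_cong word_cong.trans word_cong.sym by metis

text \<open>Letters bumped when a row with support \<open>V\<close> is inserted into a row with
  support \<open>U\<close>: those \<open>a\<close> for which \<open>V\<close> meets the interval
  from the predecessor of \<open>a\<close> in \<open>U\<close> (included) to \<open>a\<close>
  (excluded).\<close>

definition bump_set :: "nat set \<Rightarrow> nat set \<Rightarrow> nat set" where
  "bump_set U V = {a \<in> U. \<exists>x\<in>V. x < a \<and> (\<forall>y\<in>U. y < a \<longrightarrow> y \<le> x)}"

text \<open>Letters inserted earlier are smaller than the current one and are never bumped by it, so
  the growth of the row is invisible.\<close>

lemma bumps_sorted:
  "sorted_wrt (<) v \<Longrightarrow> bumps U v = concat (map (next_above U) v)"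
proof (induction v arbitrary: U)
  case (Cons x v)
  then show ?case by (auto simp: next_above_insert_le less_imp_le intro!: arg_cong[of _ _ concat])
qed simp

lemma set_next_above:
  assumes "finite U"
  shows "set (next_above U x) = {a \<in> U. x < a \<and> (\<forall>y\<in>U. y < a \<longrightarrow> y \<le> x)}"
  using assms
proof (cases rule: next_above_cases[where x = x])
  case (some m)
  then have "{a \<in> U. x < a \<and> (\<forall>y\<in>U. y < a \<longrightarrow> y \<le> x)} \<subseteq> {m}"
    by (auto simp: not_le_imp_less) (metis linorder_neqE_nat not_le)
  moreover have "y \<le> x" if "y \<in> U" "y < m" for y
    using some that by (meson leD leI)
  ultimately show ?thesis using some by (auto 4 0)
qed auto

lemma set_bumps:
  "sorted_wrt (<) v \<Longrightarrow> finite U \<Longrightarrow> set (bumps U v) = bump_set U (set v)"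
  by (auto simp: bumps_sorted set_next_above bump_set_def)

lemma sorted_bumps:
  assumes "sorted_wrt (<) v" "finite U"
  shows "sorted (bumps U v)"
  using assms(1) unfolding bumps_sorted[OF assms(1)]
proof (induction v)
  case (Cons x v)
  have "a \<le> b" if "a \<in> set (next_above U x)" "z \<in> set v" "b \<in> set (next_above U z)" for a b z
    using that Cons.prems assms(2) by (fastforce simp: set_next_above not_less[symmetric])
  moreover have "sorted (next_above U x)" by (simp add: next_above_def)
  ultimately show ?case using Cons by (auto simp: sorted_append)
qed simp

text \<open>Equal neighbours collapse by idempotence. The word bumped by a row is sorted but may
  repeat letters; this replaces it by a row.\<close>

lemma fold_N_insert_sorted:
  "sorted w \<Longrightarrow> fold N_insert w T = fold N_insert (sorted_list_of_set (set w)) T"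
proof (induction w arbitrary: T)
  case (Cons x w)
  show ?case
  proof (cases "x \<in> set w")
    case True
    then obtain y w' where w: "w = y # w'" by (cases w) auto
    with True Cons.prems have "x = y" by auto
    then have "fold N_insert (x # w) T = fold N_insert w T"
      by (simp add: w N_insert_idem del: N_insert.simps)
    also have "\<dots> = fold N_insert (sorted_list_of_set (set w)) T"
      using Cons by auto
    finally show ?thesis using True by (simp add: insert_absorb)
  next
    case False
    have "sorted_list_of_set (insert x (set w)) = x # sorted_list_of_set (set w)"
    proof -
      have "sorted_wrt (<) (x # sorted_list_of_set (set w))"
        using Cons.prems False by (auto simp: le_less)
      then show ?thesis using sorted_list_of_set_eqI[of "x # sorted_list_of_set (set w)"] by simp
    qed
    then show ?thesis using Cons by simp
  qed
qed simp

lemma rowsD: "u \<in> rows n \<Longrightarrow> sorted_wrt (<) u \<and> u \<noteq> [] \<and> set u \<subseteq> {1..n} \<and> sorted_list_of_set (set u) = u"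
  by (auto simp: rows_def sorted_list_of_set_eqI)

lemma bumps_empty: "sorted_wrt (<) v \<Longrightarrow> bumps {} v = []"
  by (simp add: bumps_sorted next_above_def)

lemma fold_N_insert_row_Nil: "u \<in> rows n \<Longrightarrow> fold N_insert u [] = [u]"
  using rowsD[of u n] by (simp add: fold_N_insert_Nil bumps_empty)

text \<open>If \<open>u \<triangleleft> v\<close>, every letter of \<open>u\<close> is bumped: the
  least one by the minimum of \<open>v\<close>, any other by its predecessor in \<open>u\<close>,
  which lies in \<open>v\<close>. So a pair is irreducible exactly when inserting \<open>v\<close>
  into \<open>u\<close> pushes \<open>u\<close> up unchanged and leaves \<open>v\<close>
  below.\<close>

lemma row_rel_iff_bump_set:
  assumes "u \<in> rows n" "v \<in> rows n"
  shows "u \<triangleleft> v \<longleftrightarrow> set u \<subseteq> set v \<and> bump_set (set u) (set v) = set u"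
proof (intro iffI conjI)
  assume uv: "u \<triangleleft> v"
  show sub: "set u \<subseteq> set v" using uv by (simp add: row_rel_def)
  show "bump_set (set u) (set v) = set u"
  proof (intro equalityI subsetI)
    fix a assume a: "a \<in> set u"
    show "a \<in> bump_set (set u) (set v)"
    proof (cases "{y \<in> set u. y < a} = {}")
      case True
      have "Min (set v) \<in> set v" using rowsD[OF assms(2)] by simp
      moreover have "Min (set v) < a"
        using uv a Min_le[of "set u" a] by (simp add: row_rel_def del: Min_le)
      ultimately show ?thesis using a True by (auto simp: bump_set_def)
    next
      case False
      have "Max {y \<in> set u. y < a} \<in> {y \<in> set u. y < a}"
        using False by (intro Max_in) auto
      moreover have "\<forall>y\<in>set u. y < a \<longrightarrow> y \<le> Max {y \<in> set u. y < a}"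
        by auto
      ultimately show ?thesis using a sub by (auto simp: bump_set_def)
    qed
  qed (auto simp: bump_set_def)
next
  assume *: "set u \<subseteq> set v \<and> bump_set (set u) (set v) = set u"
  have "Min (set u) \<in> set u" using rowsD[OF assms(1)] by simp
  then have "Min (set u) \<in> bump_set (set u) (set v)" using * by simp
  then obtain x where "x \<in> set v" "x < Min (set u)" by (auto simp: bump_set_def)
  moreover from this have "Min (set v) \<le> x" by simp
  ultimately have "Min (set v) < Min (set u)" by linarith
  with * show "u \<triangleleft> v" by (simp add: row_rel_def)
qed

text \<open>Row \<open>v\<close> takes the bottom place and bumps the whole row above it, which does
  the same in turn: all rows move up by one.\<close>

lemma fold_N_insert_row:
  "v \<in> rows n \<Longrightarrow> tableau n T \<Longrightarrow> T = [] \<or> hd T \<triangleleft> v \<Longrightarrow> fold N_insert v T = v # T"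
proof (induction T arbitrary: v)
  case Nil
  then show ?case by (simp add: fold_N_insert_row_Nil)
next
  case (Cons u T)
  then have u: "u \<in> rows n" "tableau n T" "T = [] \<or> hd T \<triangleleft> u" "u \<triangleleft> v"
    by (auto simp: tableau_Cons)
  note v = rowsD[OF Cons.prems(1)]
  have "set (bumps (set u) v) = set u" "set u \<subseteq> set v"
    using u v Cons.prems(1) row_rel_iff_bump_set[of u n v] by (simp_all add: set_bumps)
  moreover from this have "set u \<union> set v = set v" by auto
  ultimately show ?case
    using v rowsD[OF u(1)] fold_N_insert_sorted[OF sorted_bumps[of v "set u"], of T]
      Cons.IH[OF u(1,2,3)]
    by (simp add: fold_N_insert_Cons del: fold.simps N_insert.simps)
qed

lemma N_tab_concat_rev: "tableau n T \<Longrightarrow> N_tab (concat (rev T)) = T"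
proof (induction T)
  case (Cons u T)
  then show ?case
    using fold_N_insert_row[of u n T] by (simp add: N_tab_def tableau_Cons)
qed (simp add: N_tab_def)

lemma N_tab_two_rows:
  assumes "u \<in> rows n" "v \<in> rows n"
  shows "N_tab (u @ v) = sorted_list_of_set (set u \<union> set v) #
    (if bump_set (set u) (set v) = {} then [] else [sorted_list_of_set (bump_set (set u) (set v))])"
proof -
  note v = rowsD[OF assms(2)] and u = rowsD[OF assms(1)]
  let ?b = "bump_set (set u) (set v)"
  have "N_tab (u @ v) = fold N_insert v [u]"
    using assms by (simp add: N_tab_def fold_N_insert_row_Nil)
  also have "\<dots> = sorted_list_of_set (set u \<union> set v) # fold N_insert (sorted_list_of_set ?b) []"
    using v fold_N_insert_sorted[OF sorted_bumps[of v "set u"], of "[]"]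
    by (simp add: fold_N_insert_Cons set_bumps)
  moreover have "sorted_list_of_set ?b \<in> rows n" if "?b \<noteq> {}"
    using that u by (intro sorted_list_in_rows) (auto simp: bump_set_def)
  ultimately show ?thesis
    by (cases "?b = {}") (simp_all add: fold_N_insert_row_Nil)
qed

section \<open>Termination of the row presentation\<close>

abbreviation red :: "row \<Rightarrow> row \<Rightarrow> row list" where
  "red u v \<equiv> reading (N_tab (u @ v))"

text \<open>
  Since \<open>N(uv)\<close> restricted to the letters up to \<open>c\<close> depends only on the restrictions of \<open>u\<close> and \<open>v\<close>,
  the weights of a word are compared lexicographically in \<open>c\<close>. When a step changes no letter below
  \<open>c\<close> but some occurrence of \<open>c\<close>, either \<open>c\<close> is copied into a row that has smaller letters, which
  keeps it as long as no smaller letter changes, or neither row has smaller letters and \<open>c\<close> moves to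
  the right.
\<close>

fun weight :: "nat \<Rightarrow> row list \<Rightarrow> nat" where
  "weight c [] = 0"
| "weight c (u # w) =
    (if \<exists>y\<in>set u. y < c then of_bool (c \<notin> set u) else of_bool (c \<in> set u) * Suc (length w)) +
    weight c w"

lemma weight_append_less:
  "length w = length w' \<Longrightarrow> weight c w < weight c w' \<Longrightarrow> weight c (p @ w) < weight c (p @ w')"
  by (induction p) auto

lemma weight_append_eq:
  "length w = length w' \<Longrightarrow> weight c w = weight c w' \<Longrightarrow> weight c (p @ w) = weight c (p @ w')"
  by (induction p) auto

text \<open>Length settles the case where \<open>N(uv)\<close> is a single row. The weight lists all
  have length \<open>n\<close>, as \<open>lex\<close> requires.\<close>

definition row_order :: "nat \<Rightarrow> (row list \<times> row list) set" where
  "row_order n = inv_image (less_than <*lex*> lex less_than)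
    (\<lambda>w. (length w, map (\<lambda>c. weight c w) [1..<Suc n]))"

lemma wf_row_order: "wf (row_order n)"
  by (auto simp: row_order_def intro: wf_lex)

lemma weight_red:
  assumes "set b = bump_set (set u) (set v)" "set v' = set u \<union> set v" "\<not> (set u \<subseteq> set v \<and> set b = set u)"
  obtains c where "c \<in> set u" "weight c (b # v' # s) < weight c (u # v # s)"
    "\<And>c'. c' < c \<Longrightarrow> weight c' (b # v' # s) = weight c' (u # v # s)"
proof -
  \<comment> \<open>Since \<open>b\<close> lies in \<open>u\<close> and \<open>v'\<close> adds only
    letters of \<open>u\<close> to \<open>v\<close>, all changed letters belong to \<open>u\<close>:
    they are lost from the upper row or gained by the lower one. \<open>c\<close> is the least of
    them.\<close>
  let ?D = "\<lambda>c. c \<in> set u \<and> (c \<notin> set b \<or> c \<notin> set v)"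
  define c where "c = (LEAST c. ?D c)"
  have bu: "set b \<subseteq> set u" using assms(1) by (auto simp: bump_set_def)
  have "\<exists>c. ?D c" using assms(3) bu by blast
  then have c: "c \<in> set u" "c \<notin> set b \<or> c \<notin> set v" unfolding c_def by (metis (mono_tags, lifting) LeastI)+
  have low: "y \<in> set b" "y \<in> set v" if "y \<in> set u" "y < c" for y
    using not_less_Least[of y ?D] that unfolding c_def by auto
  \<comment> \<open>The predecessor of \<open>c\<close> in \<open>u\<close>, if any, lies in
    \<open>v\<close> by minimality of \<open>c\<close> and so bumps \<open>c\<close>; otherwise
    \<open>x\<close> bumps it.\<close>
  have keep: "c \<in> set b" if x: "x \<in> set v" "x < c" for x
  proof (cases "{y \<in> set u. y < c} = {}")
    case True
    then show ?thesis using c x assms(1) by (auto simp: bump_set_def)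
  next
    case False
    let ?m = "Max {y \<in> set u. y < c}"
    have "?m \<in> {y \<in> set u. y < c}" using False by (intro Max_in) auto
    moreover have "\<forall>y\<in>set u. y < c \<longrightarrow> y \<le> ?m" by auto
    ultimately show ?thesis using c low(2)[of ?m] assms(1) by (auto simp: bump_set_def)
  qed
  show ?thesis
  proof (rule that)
    show "c \<in> set u" by fact
    \<comment> \<open>Hence the same branch of \<open>weight\<close> applies to a row before and
      after the step.\<close>
    have e: "(\<exists>y\<in>set b. y < d) = (\<exists>y\<in>set u. y < d)" "(\<exists>y\<in>set v'. y < d) = (\<exists>y\<in>set v. y < d)"
      if "d \<le> c" for d
      using bu low that assms(2) by (auto dest: less_le_trans)
    show "weight c (b # v' # s) < weight c (u # v # s)"
    proof (cases "\<exists>x\<in>set v. x < c")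
      case True
      then have "c \<in> set b" using keep by auto
      then show ?thesis using True c assms(2) e[of c] by auto
    next
      case False
      then have "\<not> (\<exists>x\<in>set u. x < c)" "c \<notin> set b" using low(2) assms(1)
        by (auto simp: bump_set_def)
      then show ?thesis using False c assms(2) e[of c] by auto
    qed
    fix d assume "d < c"
    then have "d \<in> set b \<longleftrightarrow> d \<in> set u" "d \<in> set v' \<longleftrightarrow> d \<in> set v"
      using low bu assms(2) by auto
    then show "weight d (b # v' # s) = weight d (u # v # s)"
      using \<open>d < c\<close> by (simp add: e)
  qed
qed

lemma red_in_row_order:
  assumes u: "u \<in> rows n" and v: "v \<in> rows n" and uv: "\<not> u \<triangleleft> v"
  shows "(p @ red u v @ s, p @ [u, v] @ s) \<in> row_order n"
proof (cases "bump_set (set u) (set v) = {}")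
  case True
  then show ?thesis using N_tab_two_rows[OF u v] by (simp add: row_order_def reading_def)
next
  case False
  let ?b = "sorted_list_of_set (bump_set (set u) (set v))" and ?v' = "sorted_list_of_set (set u \<union> set v)"
  have red: "red u v = [?b, ?v']"
    using False N_tab_two_rows[OF u v] by (simp add: reading_def)
  have fin: "finite (bump_set (set u) (set v))" by (simp add: bump_set_def)
  obtain c where c: "c \<in> set u" "weight c (?b # ?v' # s) < weight c (u # v # s)"
    "\<And>c'. c' < c \<Longrightarrow> weight c' (?b # ?v' # s) = weight c' (u # v # s)"
    using uv row_rel_iff_bump_set[OF u v] fin by (elim weight_red[of ?b u v ?v' s, rotated 3]) auto
  have "c \<in> {1..n}" using c(1) u by (auto simp: rows_def)
  then have "[1..<Suc n] = [1..<c] @ c # [Suc c..<Suc n]"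
    using upt_add_eq_append[of 1 c "Suc n - c"] upt_conv_Cons[of c "Suc n"] by simp
  moreover have "map (\<lambda>c. weight c (p @ ?b # ?v' # s)) [1..<c] = map (\<lambda>c. weight c (p @ u # v # s)) [1..<c]"
    using c(3) by (auto intro!: weight_append_eq)
  ultimately have
    "map (\<lambda>c. weight c (p @ ?b # ?v' # s)) [1..<Suc n] = map (\<lambda>c. weight c (p @ u # v # s)) [1..<c] @
      weight c (p @ ?b # ?v' # s) # map (\<lambda>c. weight c (p @ ?b # ?v' # s)) [Suc c..<Suc n]"
    "map (\<lambda>c. weight c (p @ u # v # s)) [1..<Suc n] = map (\<lambda>c. weight c (p @ u # v # s)) [1..<c] @
      weight c (p @ u # v # s) # map (\<lambda>c. weight c (p @ u # v # s)) [Suc c..<Suc n]"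
    by (simp_all only: map_append list.map)
  then show ?thesis
    using weight_append_less[OF _ c(2), of p]
    by (simp add: red row_order_def lex_append_leftI del: upt_Suc)
qed

section \<open>Coherence\<close>

text \<open>Defined by insertion instead of rewriting, so that invariance under steps comes from the
  stylic congruence.\<close>

definition nf :: "row list \<Rightarrow> row list" where
  "nf w = reading (N_tab (concat w))"

lemma row_in_lists: "u \<in> rows n \<Longrightarrow> u \<in> lists {1..n}"
  unfolding rows_def lists_eq_set by blast

lemma concat_in_lists: "w \<in> lists (rows n) \<Longrightarrow> concat w \<in> lists {1..n}"
  by (induction w) (simp_all add: row_in_lists del: in_lists_conv_set One_nat_def)

lemma red_in_lists:
  assumes "u \<in> rows n" "v \<in> rows n"
  shows "red u v \<in> lists (rows n)"
proof -
  have "u @ v \<in> lists {1..n}" using assms[THEN row_in_lists] by simp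
  then have "tableau n (N_tab (u @ v))" by (rule tableau_N_tab)
  then have "set (N_tab (u @ v)) \<subseteq> rows n" unfolding tableau_def by (rule conjunct1)
  then show ?thesis unfolding reading_def lists_eq_set by simp
qed

lemma N_tab_append_cong:
  "(x, y) \<in> styl_cong n \<Longrightarrow> N_tab (a @ x @ b) = N_tab (a @ y @ b)"
  using fold_N_insert_cong[of x y n "fold N_insert a []"] by (simp add: N_tab_def)

lemma N_tab_red:
  assumes "u \<in> rows n" "v \<in> rows n"
  shows "N_tab (concat (p @ red u v @ s)) = N_tab (concat (p @ [u, v] @ s))"
proof -
  have "u @ v \<in> lists {1..n}" using assms[THEN row_in_lists] by simp
  from N_tab_append_cong[OF styl_cong_reading[OF this], of "concat p" "concat s"] show ?thesis
    by simp
qed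

lemma nf_red: "u \<in> rows n \<Longrightarrow> v \<in> rows n \<Longrightarrow> nf (p @ red u v @ s) = nf (p @ [u, v] @ s)"
  unfolding nf_def by (simp only: N_tab_red)

lemma nf_normal:
  assumes "w \<in> lists (rows n)" "successively (\<triangleleft>) w"
  shows "nf w = w"
proof -
  have "tableau n (rev w)" using assms by (auto simp: tableau_def successively_rev)
  from N_tab_concat_rev[OF this] show ?thesis by (simp add: nf_def reading_def)
qed

lemma leftmost_failure:
  assumes "\<not> successively R w"
  obtains p u v s where "w = p @ [u, v] @ s" "successively R (p @ [u])" "\<not> R u v"
  using assms
proof (induction w arbitrary: thesis rule: induct_list012)
  case (3 x y zs)
  show ?case
  proof (cases "R x y")
    case False
    then show ?thesis using 3(3)[of "[]" x y zs] by simp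
  next
    case True
    with 3(4) have "\<not> successively R (y # zs)" by simp
    then obtain p u v s where *: "y # zs = p @ [u, v] @ s" "successively R (p @ [u])" "\<not> R u v"
      by (rule 3(2)[rotated])
    from * True have "successively R ((x # p) @ [u])"
      by (cases p) auto
    with * show ?thesis using 3(3)[of "x # p" u v s] by simp
  qed
qed auto

text \<open>\<Lambda> is a definite description; existence of its value rests on
  termination.\<close>

lemma leftmost_path_exists:
  "w \<in> lists (rows n) \<Longrightarrow> \<exists>f. leftmost_path w f"
  using wf_row_order[of n]
proof (induction w rule: wf_induct_rule)
  case (less w)
  show ?case
  proof (cases "successively (\<triangleleft>) w")
    case True
    then show ?thesis by (blast intro: leftmost_path.normal)
  next
    case False
    then obtain p u v s where w: "w = p @ [u, v] @ s" "successively (\<triangleleft>) (p @ [u])" "\<not> u \<triangleleft> v"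
      by (rule leftmost_failure)
    have uv: "u \<in> rows n" "v \<in> rows n" using less.prems w by auto
    have "\<exists>f. leftmost_path (p @ red u v @ s) f"
      using red_in_row_order[OF uv w(3), of p s] red_in_lists[OF uv] less.prems w(1)
      by (intro less.IH) auto
    then show ?thesis unfolding w(1) using leftmost_path.step[OF w(2,3)] by blast
  qed
qed

lemma \<Lambda>_eqI:
  assumes "leftmost_path w f"
  shows "\<Lambda> w = f"
  unfolding \<Lambda>_def
  by (rule the_equality[where P = "leftmost_path w", OF assms]) (rule leftmost_path_unique[OF _ assms])

lemma leftmost_path_\<Lambda>:
  assumes "w \<in> lists (rows n)"
  shows "leftmost_path w (\<Lambda> w)"
proof -
  obtain f where "leftmost_path w f" using leftmost_path_exists[OF assms] ..
  then show ?thesis by (simp add: \<Lambda>_eqI)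
qed

lemma \<Lambda>_step:
  assumes "successively (\<triangleleft>) (p @ [u])" "\<not> u \<triangleleft> v" "p @ [u, v] @ s \<in> lists (rows n)"
  shows "\<Lambda> (p @ [u, v] @ s) = whisk p (\<alpha> u v) s \<star>\<^sub>1 \<Lambda> (p @ red u v @ s)"
proof -
  have "p @ red u v @ s \<in> lists (rows n)" using assms(3) red_in_lists[of u n v] by auto
  from \<Lambda>_eqI[OF leftmost_path.step[OF assms(1,2) leftmost_path_\<Lambda>[OF this]]] show ?thesis .
qed

lemma row_coh_simps [simp]:
  "cells1 (row_coh n) = rows n"
  "cells2 (row_coh n) = {(u, v). u \<in> rows n \<and> v \<in> rows n \<and> \<not> u \<triangleleft> v}"
  "src2 (row_coh n) = (\<lambda>(u, v). [u, v])"
  "tgt2 (row_coh n) = (\<lambda>(u, v). red u v)"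
  "cells3 (row_coh n) =
    {(u, v, t). u \<in> rows n \<and> v \<in> rows n \<and> t \<in> rows n \<and> \<not> u \<triangleleft> v \<and> \<not> v \<triangleleft> t}"
  "src3 (row_coh n) = (\<lambda>(u, v, t). (\<alpha> u v \<star>\<^sub>0 Id1 [t]) \<star>\<^sub>1 \<Lambda> (red u v @ [t]))"
  "tgt3 (row_coh n) = (\<lambda>(u, v, t). (Id1 [u] \<star>\<^sub>0 \<alpha> v t) \<star>\<^sub>1 \<Lambda> ([u] @ red v t))"
  by (simp_all add: row_coh_def row_presentation_def polygraph2.defs)

lemma is_polygraph2_row_coh: "is_polygraph2 (row_coh n)"
  using red_in_lists by (auto simp: is_polygraph2_def)

lemma cell2_\<alpha>:
  "u \<in> rows n \<Longrightarrow> v \<in> rows n \<Longrightarrow> \<not> u \<triangleleft> v \<Longrightarrow> cell2 (row_coh n) (\<alpha> u v) [u, v] (red u v)"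
  using cell2.gen[of "(u, v)" "row_coh n"] by simp

lemma cell2_step:
  "p @ [u, v] @ s \<in> lists (rows n) \<Longrightarrow> \<not> u \<triangleleft> v \<Longrightarrow>
    cell2 (row_coh n) (whisk p (\<alpha> u v) s) (p @ [u, v] @ s) (p @ red u v @ s)"
  by (intro cell2_whisk cell2_\<alpha>) auto

lemma cell2_leftmost_path:
  "leftmost_path w f \<Longrightarrow> w \<in> lists (rows n) \<Longrightarrow> cell2 (row_coh n) f w (nf w)"
proof (induction rule: leftmost_path.induct)
  case (normal w)
  then show ?case by (simp add: nf_normal cell2.id)
next
  case (step p u v s f)
  then have uv: "u \<in> rows n" "v \<in> rows n" by auto
  have "cell2 (row_coh n) f (p @ red u v @ s) (nf (p @ red u v @ s))"
    using step red_in_lists[OF uv] by (intro step.IH) auto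
  with cell2_step[OF step.prems step.hyps(2)] show ?case
    unfolding nf_red[OF uv] by (rule cell2.comp1)
qed

lemma cell2_\<Lambda>: "w \<in> lists (rows n) \<Longrightarrow> cell2 (row_coh n) (\<Lambda> w) w (nf w)"
  by (rule cell2_leftmost_path[OF leftmost_path_\<Lambda>])

section \<open>Coherence of single rewriting steps\<close>

definition coherent_steps :: "nat \<Rightarrow> row list \<Rightarrow> bool" where
  "coherent_steps n w \<longleftrightarrow> (\<forall>p u v s. w = p @ [u, v] @ s \<longrightarrow> \<not> u \<triangleleft> v \<longrightarrow>
    htpy (row_coh n) (whisk p (\<alpha> u v) s \<star>\<^sub>1 \<Lambda> (p @ red u v @ s)) (\<Lambda> w))"

text \<open>With \<open>p\<close> in front, the steps of \<open>f\<close> may cease to be leftmost.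
  Each of them is still a rewriting step at a word reached from \<open>p @ x @ s\<close>, where
  coherence is assumed, so the path is absorbed into \<Lambda> from its end.\<close>

lemma htpy_leftmost_path:
  assumes "leftmost_path x f" "p @ x @ s \<in> lists (rows n)"
    and "\<And>w. w \<in> lists (rows n) \<Longrightarrow> (w, p @ x @ s) \<in> (row_order n)\<^sup>* \<Longrightarrow> coherent_steps n w"
  shows "htpy (row_coh n) (whisk p f s \<star>\<^sub>1 \<Lambda> (p @ nf x @ s)) (\<Lambda> (p @ x @ s))"
  using assms
proof (induction rule: leftmost_path.induct)
  case (normal w)
  then have "nf w = w" using nf_normal[of w n] by auto
  with normal cell2_\<Lambda>[OF normal(2)] show ?case
    by (auto intro!: htpy_whisk_Id_comp1)
next
  case (step q u v t f)
  let ?P = "row_coh n" and ?x = "q @ red u v @ t"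
  have L: "p \<in> lists (cells1 ?P)" "s \<in> lists (cells1 ?P)" "q \<in> lists (cells1 ?P)"
    "t \<in> lists (cells1 ?P)" and uv: "u \<in> rows n" "v \<in> rows n"
    using step.prems by auto
  have x: "?x \<in> lists (rows n)" using L red_in_lists[OF uv] by auto
  have pxs: "p @ ?x @ s \<in> lists (rows n)" using L x by auto
  have ord: "(p @ ?x @ s, p @ (q @ [u, v] @ t) @ s) \<in> row_order n"
    using red_in_row_order[OF uv step.hyps(2), of "p @ q" "t @ s"] by simp
  have "nf ?x = nf (q @ [u, v] @ t)" by (rule nf_red[OF uv])
  have IH: "htpy ?P (whisk p f s \<star>\<^sub>1 \<Lambda> (p @ nf ?x @ s)) (\<Lambda> (p @ ?x @ s))"
    using pxs ord step.prems(2) by (intro step.IH) (auto intro: rtrancl_into_rtrancl)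
  have z: "nf ?x \<in> lists (rows n)"
    using tableau_N_tab[OF concat_in_lists[OF x]] by (auto simp: nf_def tableau_def reading_def)
  have c\<alpha>: "cell2 ?P (whisk q (\<alpha> u v) t) (q @ [u, v] @ t) ?x"
    using step L uv by (intro cell2_step) auto
  have cf: "cell2 ?P f ?x (nf ?x)"
    by (rule cell2_leftmost_path[OF step.hyps(3) x])
  have c\<Lambda>: "cell2 ?P (\<Lambda> (p @ nf ?x @ s)) (p @ nf ?x @ s) (nf (p @ nf ?x @ s))"
    using L z by (intro cell2_\<Lambda>) auto
  note cw = cell2_whisk[OF c\<alpha> L(1,2)] and cfw = cell2.comp1[OF cell2_whisk[OF cf L(1,2)] c\<Lambda>]
  have "htpy ?P (whisk p (whisk q (\<alpha> u v) t \<star>\<^sub>1 f) s \<star>\<^sub>1 \<Lambda> (p @ nf ?x @ s))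
    (whisk p (whisk q (\<alpha> u v) t) s \<star>\<^sub>1 (whisk p f s \<star>\<^sub>1 \<Lambda> (p @ nf ?x @ s)))"
    by (rule htpy_whisk_comp1_assoc[OF c\<alpha> cf c\<Lambda> L(1,2)])
  also have "htpy ?P \<dots> (whisk (p @ q) (\<alpha> u v) (t @ s) \<star>\<^sub>1 \<Lambda> (p @ ?x @ s))"
    by (rule htpy_comp1[OF htpy_eq2[OF eq2_whisk_whisk[OF cell2_\<alpha>[OF uv step.hyps(2)] L] cw] IH cw cfw])
  also have "htpy ?P \<dots> (\<Lambda> (p @ (q @ [u, v] @ t) @ s))"
  proof -
    have "coherent_steps n (p @ (q @ [u, v] @ t) @ s)"
      using step.prems(1) by (intro step.prems(2)) auto
    then show ?thesis using step.hyps(2)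
      unfolding coherent_steps_def by (elim allE[of _ "p @ q"] allE[of _ u] allE[of _ v] allE[of _ "t @ s"]) simp
  qed
  finally show ?case unfolding nf_red[OF uv] .
qed

lemma coherent_steps_rows: "w \<in> lists (rows n) \<Longrightarrow> coherent_steps n w"
  \<comment> \<open>Whiskered normalization paths visit words several steps below \<open>w\<close>,
    hence the transitive closure.\<close>
  using wf_trancl[OF wf_row_order[of n]]
proof (induction w rule: wf_induct_rule)
  case (less w)
  let ?P = "row_coh n"
  show ?case
    unfolding coherent_steps_def
  proof (intro allI impI)
    fix p u v s assume w: "w = p @ [u, v] @ s" and uv: "\<not> u \<triangleleft> v"
    have L: "p \<in> lists (rows n)" "s \<in> lists (rows n)" and uvL: "u \<in> rows n" "v \<in> rows n"
      using less.prems w by auto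
    have "\<not> successively (\<triangleleft>) w" using w uv by (auto simp: successively_append_iff)
    then obtain p0 u0 v0 s0 where w0: "w = p0 @ [u0, v0] @ s0" "successively (\<triangleleft>) (p0 @ [u0])" "\<not> u0 \<triangleleft> v0"
      by (rule leftmost_failure)
    have L0: "p0 \<in> lists (rows n)" "s0 \<in> lists (rows n)" and uvL0: "u0 \<in> rows n" "v0 \<in> rows n"
      using less.prems w0(1) by auto
    have \<Lambda>w: "\<Lambda> w = whisk p0 (\<alpha> u0 v0) s0 \<star>\<^sub>1 \<Lambda> (p0 @ red u0 v0 @ s0)"
      unfolding w0(1) using less.prems w0 by (intro \<Lambda>_step) auto
    have less_coherent: "coherent_steps n w'"
      if "w' \<in> lists (rows n)" "(w', w'') \<in> (row_order n)\<^sup>*" "(w'', w) \<in> row_order n" for w' w''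
      using that by (intro less.IH) (auto intro: rtrancl_into_trancl1)
    consider (same) "p = p0" "u = u0" "v = v0" "s = s0"
      | (overlap) "p = p0 @ [u0]" "u = v0" "s0 = v # s"
      | (disjoint) q where "p = p0 @ [u0, v0] @ q" "s0 = q @ [u, v] @ s"
    proof -
      from w w0(1) have "p @ [u, v] @ s = p0 @ [u0, v0] @ s0" by simp
      then obtain q where "p = p0 @ q \<and> q @ [u, v] @ s = [u0, v0] @ s0 \<or>
          p @ q = p0 \<and> [u, v] @ s = q @ [u0, v0] @ s0"
        unfolding append_eq_append_conv2 by blast
      then show thesis
      proof (elim disjE conjE)
        assume q: "p = p0 @ q" "q @ [u, v] @ s = [u0, v0] @ s0"
        show thesis
        proof (cases q)
          case Nil
          then show ?thesis using q by (intro same) auto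
        next
          case (Cons x q')
          then show ?thesis using q by (cases q') (auto intro: overlap disjoint)
        qed
      next
        assume q: "p @ q = p0" "[u, v] @ s = q @ [u0, v0] @ s0"
        show thesis
        proof (cases q)
          case Nil
          then show ?thesis using q by (intro same) auto
        next
          case (Cons x q')
          \<comment> \<open>A redex starting earlier would lie inside \<open>p0 @ [u0]\<close>,
            which is irreducible.\<close>
          then have "u \<triangleleft> v" using q w0(2) by (cases q') (auto simp: successively_append_iff)
          with uv show ?thesis ..
        qed
      qed
    qed
    then show "htpy ?P (whisk p (\<alpha> u v) s \<star>\<^sub>1 \<Lambda> (p @ red u v @ s)) (\<Lambda> w)"
    proof cases
      case same
      then show ?thesis using \<Lambda>w cell2_\<Lambda>[OF less.prems] by (auto intro: htpy_refl)
    next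
      case disjoint
      let ?f = "whisk p (\<alpha> u v) s" and ?g = "whisk p0 (\<alpha> u0 v0) s0"
      let ?f' = "whisk (p0 @ red u0 v0 @ q) (\<alpha> u v) s"
      let ?g' = "whisk p0 (\<alpha> u0 v0) (q @ red u v @ s)"
      let ?w2 = "p0 @ red u0 v0 @ s0" and ?w3 = "p0 @ red u0 v0 @ q @ red u v @ s"
      have q: "q \<in> lists (rows n)" using L disjoint by auto
      note R = red_in_lists[OF uvL] red_in_lists[OF uvL0]
      have w3: "?w3 \<in> lists (rows n)" using R L L0 q by auto
      have w2: "?w2 \<in> lists (rows n)" using R L0 by auto
      \<comment> \<open>Rewriting further to the right leaves \<open>p0 @ [u0, v0]\<close> intact,
        so \<Lambda> still begins with that redex.\<close>
      have w1: "\<Lambda> (p @ red u v @ s) = ?g' \<star>\<^sub>1 \<Lambda> ?w3"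
        using \<Lambda>_step[OF w0(2,3), of "q @ red u v @ s" n] L0 uvL0 R q L disjoint by auto
      have c: "cell2 ?P ?f w (p @ red u v @ s)" "cell2 ?P ?g w ?w2"
        "cell2 ?P ?g' (p @ red u v @ s) ?w3" "cell2 ?P ?f' ?w2 ?w3"
        using cell2_step[of p u v s n] cell2_step[of p0 u0 v0 s0 n]
          cell2_step[of p0 u0 v0 "q @ red u v @ s" n] cell2_step[of "p0 @ red u0 v0 @ q" u v s n]
          L L0 uvL uvL0 R q w w0 disjoint uv less.prems by auto
      note c\<Lambda> = cell2_\<Lambda>[OF w3]
      have ex: "eq2 ?P (?f \<star>\<^sub>1 ?g') (?g \<star>\<^sub>1 ?f')"
        using eq2_whisk_exchange[OF cell2_\<alpha>[OF uvL0 w0(3)] cell2_\<alpha>[OF uvL uv], of p0 q s]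
          L L0 uvL uvL0 R q disjoint by auto
      have "htpy ?P (?f \<star>\<^sub>1 (?g' \<star>\<^sub>1 \<Lambda> ?w3)) ((?f \<star>\<^sub>1 ?g') \<star>\<^sub>1 \<Lambda> ?w3)"
        by (rule htpy_eq2'[OF eq2.assoc1[OF c(1,3) c\<Lambda>] cell2.comp1[OF c(1) cell2.comp1[OF c(3) c\<Lambda>]]])
      also have "htpy ?P \<dots> ((?g \<star>\<^sub>1 ?f') \<star>\<^sub>1 \<Lambda> ?w3)"
        by (rule htpy_comp1[OF htpy_eq2[OF ex] htpy_refl[OF c\<Lambda>]]) (rule cell2.comp1 c c\<Lambda>)+
      also have "htpy ?P \<dots> (?g \<star>\<^sub>1 (?f' \<star>\<^sub>1 \<Lambda> ?w3))"
        by (rule htpy_eq2[OF eq2.assoc1[OF c(2,4) c\<Lambda>] cell2.comp1[OF cell2.comp1[OF c(2,4)] c\<Lambda>]])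
      also have "htpy ?P \<dots> (?g \<star>\<^sub>1 \<Lambda> ?w2)"
      proof -
        have "coherent_steps n ?w2"
          using red_in_row_order[OF uvL0 w0(3)] w0(1) w2 by (intro less_coherent[OF _ rtrancl_refl]) auto
        then have "htpy ?P (?f' \<star>\<^sub>1 \<Lambda> ?w3) (\<Lambda> ?w2)"
          using uv disjoint unfolding coherent_steps_def
          by (elim allE[of _ "p0 @ red u0 v0 @ q"] allE[of _ u] allE[of _ v] allE[of _ s]) simp
        then show ?thesis
          by (rule htpy_comp1[OF htpy_refl[OF c(2)] _ c(2) cell2.comp1[OF c(4) c\<Lambda>]])
      qed
      finally show ?thesis by (simp only: \<Lambda>w w1)
    next
      case overlap
      note [simp] = overlap
      let ?x1 = "red u0 u @ [v]" and ?x2 = "[u0] @ red u v"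
      note R = red_in_lists[OF uvL] red_in_lists[OF uvL0]
      have x: "?x1 \<in> lists (rows n)" "?x2 \<in> lists (rows n)" "[v] \<in> lists (rows n)" "[u0] \<in> lists (rows n)"
        using R uvL0 uvL by auto
      \<comment> \<open>Common target of both sides of the 3-cell indexed by
        \<open>(u0, u, v)\<close>. Between \<open>p0\<close> and \<open>s\<close> it may be
        reducible again, so both sides are continued by \<Lambda>.\<close>
      define z where "z = nf [u0, u, v]"
      have nf: "nf ?x1 = z" "nf ?x2 = z"
        using nf_red[OF uvL0, of "[]" "[v]"] nf_red[OF uvL, of "[u0]" "[]"]
        by (simp_all add: z_def)
      have zL: "z \<in> lists (rows n)"
        using cell2_in_lists[OF is_polygraph2_row_coh cell2_\<Lambda>[OF x(1)]] nf by simp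
      let ?\<Lambda>z = "\<Lambda> (p0 @ z @ s)"
      have c\<Lambda>: "cell2 ?P (\<Lambda> ?x1) ?x1 z" "cell2 ?P (\<Lambda> ?x2) ?x2 z"
          "cell2 ?P ?\<Lambda>z (p0 @ z @ s) (nf (p0 @ z @ s))"
        using cell2_\<Lambda>[OF x(1)] cell2_\<Lambda>[OF x(2)] cell2_\<Lambda>[of "p0 @ z @ s" n] nf zL L0 L by auto
      let ?f = "whisk [u0] (\<alpha> u v) []" and ?g = "whisk [] (\<alpha> u0 u) [v]"
      have c: "cell2 ?P ?g [u0, u, v] ?x1" "cell2 ?P ?f [u0, u, v] ?x2"
        using cell2_step[of "[]" u0 u "[v]" n] cell2_step[of "[u0]" u v "[]" n] uv w0(3) uvL uvL0 by auto
      have L': "p0 \<in> lists (cells1 ?P)" "s \<in> lists (cells1 ?P)" "[] \<in> lists (cells1 ?P)"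
        "[u0] \<in> lists (cells1 ?P)" "[v] \<in> lists (cells1 ?P)"
        using L0 L x by auto
      note cw = cell2_whisk[OF c(1) L'(1,2)] cell2_whisk[OF c(2) L'(1,2)]
        cell2_whisk[OF c\<Lambda>(1) L'(1,2)] cell2_whisk[OF c\<Lambda>(2) L'(1,2)]
      have w': "p0 @ [u0, u, v] @ s = w" using w by simp
      have path: "htpy ?P (whisk p0 (\<Lambda> ?x1) s \<star>\<^sub>1 ?\<Lambda>z) (\<Lambda> (p0 @ ?x1 @ s))"
        "htpy ?P (whisk p0 (\<Lambda> ?x2) s \<star>\<^sub>1 ?\<Lambda>z) (\<Lambda> (p0 @ ?x2 @ s))"
      proof -
        have "(p0 @ ?x1 @ s, w) \<in> row_order n" "(p0 @ ?x2 @ s, w) \<in> row_order n"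
          using red_in_row_order[OF uvL0 w0(3), of p0 "v # s"] red_in_row_order[OF uvL uv, of "p0 @ [u0]" s] w
          by simp_all
        with less_coherent x L L0 show "htpy ?P (whisk p0 (\<Lambda> ?x1) s \<star>\<^sub>1 ?\<Lambda>z) (\<Lambda> (p0 @ ?x1 @ s))"
          "htpy ?P (whisk p0 (\<Lambda> ?x2) s \<star>\<^sub>1 ?\<Lambda>z) (\<Lambda> (p0 @ ?x2 @ s))"
          using htpy_leftmost_path[OF leftmost_path_\<Lambda>[OF x(1)], of p0 s n]
            htpy_leftmost_path[OF leftmost_path_\<Lambda>[OF x(2)], of p0 s n] nf
          by (metis append_in_lists_conv)+
      qed
      have ww: "eq2 ?P (whisk p0 ?g s) (whisk p0 (\<alpha> u0 u) (v # s))"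
        "eq2 ?P (whisk p0 ?f s) (whisk (p0 @ [u0]) (\<alpha> u v) s)"
        using eq2_whisk_whisk[OF cell2_\<alpha>[OF uvL0 w0(3)] L'(1,2,3,5)]
          eq2_whisk_whisk[OF cell2_\<alpha>[OF uvL uv] L'(1,2,4,3)] by simp_all
      \<comment> \<open>This is the generating 3-cell, with empty whiskers added so that both sides
        start with a step in context.\<close>
      have \<chi>: "htpy ?P (?g \<star>\<^sub>1 \<Lambda> ?x1) (?f \<star>\<^sub>1 \<Lambda> ?x2)"
      proof -
        have c0: "cell2 ?P (\<alpha> u0 u \<star>\<^sub>0 Id1 [v]) [u0, u, v] ?x1"
          using cell2.comp0[OF cell2_\<alpha>[OF uvL0 w0(3)] cell2.id[of "[v]"]] uvL by simp
        have "htpy ?P (?g \<star>\<^sub>1 \<Lambda> ?x1) ((\<alpha> u0 u \<star>\<^sub>0 Id1 [v]) \<star>\<^sub>1 \<Lambda> ?x1)"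
          using c0 by (intro htpy_comp1[OF _ htpy_refl[OF c\<Lambda>(1)] c(1) c\<Lambda>(1)] htpy_eq2[OF eq2.unit0_left c(1)]) simp
        also have "htpy ?P \<dots> ((Id1 [u0] \<star>\<^sub>0 \<alpha> u v) \<star>\<^sub>1 \<Lambda> ?x2)"
          using htpy_gen[of "(u0, u, v)" ?P] uvL uvL0 uv w0(3) by simp
        also have "htpy ?P \<dots> (?f \<star>\<^sub>1 \<Lambda> ?x2)"
          by (rule htpy_sym, rule htpy_comp1[OF _ htpy_refl[OF c\<Lambda>(2)] c(2) c\<Lambda>(2)])
            (rule htpy_eq2[OF eq2.cong0[OF eq2.refl[OF cell2.id[OF L'(4)]] eq2.unit0_right[OF cell2_\<alpha>[OF uvL uv]]] c(2)])
        finally show ?thesis .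
      qed
      have "htpy ?P (whisk p0 (?g \<star>\<^sub>1 \<Lambda> ?x1) s \<star>\<^sub>1 ?\<Lambda>z) (\<Lambda> w)"
      proof -
        have "htpy ?P (whisk p0 (?g \<star>\<^sub>1 \<Lambda> ?x1) s \<star>\<^sub>1 ?\<Lambda>z) (whisk p0 ?g s \<star>\<^sub>1 (whisk p0 (\<Lambda> ?x1) s \<star>\<^sub>1 ?\<Lambda>z))"
          by (rule htpy_whisk_comp1_assoc[OF c(1) c\<Lambda>(1,3) L'(1,2)])
        also have "htpy ?P \<dots> (whisk p0 (\<alpha> u0 u) (v # s) \<star>\<^sub>1 \<Lambda> (p0 @ ?x1 @ s))"
          by (rule htpy_comp1[OF htpy_eq2[OF ww(1) cw(1)] path(1) cw(1) cell2.comp1[OF cw(3) c\<Lambda>(3)]])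
        finally show ?thesis by (simp add: \<Lambda>w)
      qed
      moreover have "htpy ?P (whisk p0 (?f \<star>\<^sub>1 \<Lambda> ?x2) s \<star>\<^sub>1 ?\<Lambda>z) (whisk p (\<alpha> u v) s \<star>\<^sub>1 \<Lambda> (p @ red u v @ s))"
      proof -
        have "htpy ?P (whisk p0 (?f \<star>\<^sub>1 \<Lambda> ?x2) s \<star>\<^sub>1 ?\<Lambda>z) (whisk p0 ?f s \<star>\<^sub>1 (whisk p0 (\<Lambda> ?x2) s \<star>\<^sub>1 ?\<Lambda>z))"
          by (rule htpy_whisk_comp1_assoc[OF c(2) c\<Lambda>(2,3) L'(1,2)])
        also have "htpy ?P \<dots> (whisk (p0 @ [u0]) (\<alpha> u v) s \<star>\<^sub>1 \<Lambda> (p0 @ ?x2 @ s))"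
          by (rule htpy_comp1[OF htpy_eq2[OF ww(2) cw(2)] path(2) cw(2) cell2.comp1[OF cw(4) c\<Lambda>(3)]])
        finally show ?thesis by simp
      qed
      moreover have "htpy ?P (whisk p0 (?g \<star>\<^sub>1 \<Lambda> ?x1) s \<star>\<^sub>1 ?\<Lambda>z) (whisk p0 (?f \<star>\<^sub>1 \<Lambda> ?x2) s \<star>\<^sub>1 ?\<Lambda>z)"
        by (rule htpy_comp1[OF htpy_whisk[OF \<chi> L'(1,2)] htpy_refl[OF c\<Lambda>(3)]
              cell2_whisk[OF cell2.comp1[OF c(1) c\<Lambda>(1)] L'(1,2)] c\<Lambda>(3)])
      ultimately show ?thesis by (blast intro: htpy_trans htpy_sym)
    qed
  qed
qed

section \<open>Assembling the finite coherent presentation\<close>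

lemma contraction_row_coh: "contraction (row_coh n) \<Lambda> nf"
proof
  fix b p s
  assume b: "b \<in> cells2 (row_coh n)" and ps: "p \<in> lists (cells1 (row_coh n))" "s \<in> lists (cells1 (row_coh n))"
  obtain u v where uv: "b = (u, v)" "u \<in> rows n" "v \<in> rows n" "\<not> u \<triangleleft> v" using b by auto
  have "coherent_steps n (p @ [u, v] @ s)"
    using ps uv by (intro coherent_steps_rows) auto
  then show "nf (p @ tgt2 (row_coh n) b @ s) = nf (p @ src2 (row_coh n) b @ s) \<and>
      htpy (row_coh n) (whisk p (Gen2 b) s \<star>\<^sub>1 \<Lambda> (p @ tgt2 (row_coh n) b @ s)) (\<Lambda> (p @ src2 (row_coh n) b @ s))"
    using uv nf_red[OF uv(2,3), of p s] unfolding coherent_steps_def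
    by (elim allE[of _ p] allE[of _ u] allE[of _ v] allE[of _ s]) simp
qed (use is_polygraph2_row_coh cell2_\<Lambda> in auto)

lemma is_polygraph31_row_coh: "is_polygraph31 (row_coh n)"
proof -
  have "parallel (row_coh n) ((\<alpha> u v \<star>\<^sub>0 Id1 [t]) \<star>\<^sub>1 \<Lambda> (red u v @ [t])) ((Id1 [u] \<star>\<^sub>0 \<alpha> v t) \<star>\<^sub>1 \<Lambda> ([u] @ red v t))"
    if uvt: "u \<in> rows n" "v \<in> rows n" "t \<in> rows n" "\<not> u \<triangleleft> v" "\<not> v \<triangleleft> t" for u v t
  proof -
    have nf: "nf (red u v @ [t]) = nf ([u] @ red v t)"
      using nf_red[OF uvt(1,2), of "[]" "[t]"] nf_red[OF uvt(2,3), of "[u]" "[]"] by simp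
    have "cell2 (row_coh n) (\<alpha> u v \<star>\<^sub>0 Id1 [t]) ([u, v] @ [t]) (red u v @ [t])"
      "cell2 (row_coh n) (Id1 [u] \<star>\<^sub>0 \<alpha> v t) ([u] @ [v, t]) ([u] @ red v t)"
      using uvt by (intro cell2.comp0 cell2_\<alpha> cell2.id; simp)+
    moreover have "cell2 (row_coh n) (\<Lambda> (red u v @ [t])) (red u v @ [t]) (nf (red u v @ [t]))"
      using red_in_lists[OF uvt(1,2)] uvt by (intro cell2_\<Lambda>) auto
    moreover have "cell2 (row_coh n) (\<Lambda> ([u] @ red v t)) ([u] @ red v t) (nf (red u v @ [t]))"
      unfolding nf using red_in_lists[OF uvt(2,3)] uvt by (intro cell2_\<Lambda>) auto
    ultimately have "cell2 (row_coh n) ((\<alpha> u v \<star>\<^sub>0 Id1 [t]) \<star>\<^sub>1 \<Lambda> (red u v @ [t])) ([u, v, t]) (nf (red u v @ [t]))"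
      "cell2 (row_coh n) ((Id1 [u] \<star>\<^sub>0 \<alpha> v t) \<star>\<^sub>1 \<Lambda> ([u] @ red v t)) ([u, v, t]) (nf (red u v @ [t]))"
      by (auto intro: cell2.comp1)
    then show ?thesis by (auto simp: parallel_def)
  qed
  then show ?thesis using is_polygraph2_row_coh by (auto simp: is_polygraph31_def)
qed

lemma finite_rows: "finite (rows n)"
proof (rule inj_on_finite)
  show "inj_on set (rows n)" by (rule inj_onI) (metis rowsD)
  show "set ` rows n \<subseteq> Pow {1..n}" by (auto simp: rows_def)
qed simp

lemma finite_row_coh: "finite_polygraph31 (row_coh n)"
  unfolding finite_polygraph31_def
proof (intro conjI)
  show "finite (cells2 (row_coh n))"
    by (rule finite_subset[of _ "rows n \<times> rows n"]) (auto simp: finite_rows)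
  show "finite (cells3 (row_coh n))"
    by (rule finite_subset[of _ "rows n \<times> rows n \<times> rows n"]) (auto simp: finite_rows)
qed (simp add: finite_rows)

text \<open>Steps preserve the tableau, and \<Lambda> joins every word to a normal form that depends
  on its tableau only.\<close>

lemma row_cong_iff:
  assumes "w \<in> lists (rows n)" "w' \<in> lists (rows n)"
  shows "(w, w') \<in> word_cong (cells1 (row_coh n)) {(src2 (row_coh n) b, tgt2 (row_coh n) b) |b. b \<in> cells2 (row_coh n)}
    \<longleftrightarrow> N_tab (concat w) = N_tab (concat w')" (is "_ \<in> ?C \<longleftrightarrow> _")
proof
  show "N_tab (concat w) = N_tab (concat w')" if "(w, w') \<in> ?C"
    using that
  proof induction
    case (base u v p s)
    then show ?case using N_tab_red by fastforce
  qed auto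
next
  assume eq: "N_tab (concat w) = N_tab (concat w')"
  have "(x, nf x) \<in> ?C" if "x \<in> lists (rows n)" for x
    by (rule cell2_imp_word_cong[OF is_polygraph2_row_coh cell2_\<Lambda>[OF that]])
  from this[OF assms(1)] this[OF assms(2)] show "(w, w') \<in> ?C"
    using eq by (simp add: nf_def) (blast intro: word_cong.trans word_cong.sym)
qed

text \<open>The isomorphism is induced by \<open>concat\<close>: on both sides congruence means
  equality of tableaux, and one-letter rows reach every word.\<close>

lemma row_coh_presents_Styl: "presents (row_coh n) (Styl n)"
  unfolding presents_def polygraph_monoid_def Styl_def
proof (rule presented_monoid_iso[where h = concat])
  fix u v assume "u \<in> lists (cells1 (row_coh n))" "v \<in> lists (cells1 (row_coh n))"
  then have uv: "u \<in> lists (rows n)" "v \<in> lists (rows n)" by simp_all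
  show "(u, v) \<in> word_cong (cells1 (row_coh n)) {(src2 (row_coh n) b, tgt2 (row_coh n) b) |b. b \<in> cells2 (row_coh n)}
    \<longleftrightarrow> (concat u, concat v) \<in> styl_cong n"
    using row_cong_iff[OF uv] styl_cong_iff[OF uv[THEN concat_in_lists]] by blast
next
  fix w assume w: "w \<in> lists {1..n}"
  have "concat (map (\<lambda>x. [x]) w) = w" by simp
  moreover have "map (\<lambda>x. [x]) w \<in> lists (rows n)" using w by (auto simp: rows_def)
  ultimately show "\<exists>u\<in>lists (cells1 (row_coh n)). (concat u, w) \<in> styl_cong n"
    using w by (intro bexI[of _ "map (\<lambda>x. [x]) w"]) (auto intro: word_cong.refl)
qed (simp_all add: concat_in_lists del: in_lists_conv_set One_nat_def)

theorem theorem3p2p6: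
  fixes n :: nat
  assumes "n \<ge> 1"
  shows "finite_polygraph31 (row_coh n) \<and> coherent_presentation (row_coh n) (Styl n)"
  unfolding coherent_presentation_def
  using finite_row_coh is_polygraph31_row_coh row_coh_presents_Styl
    contraction.homotopy_basis[OF contraction_row_coh]
  by blast

end
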